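(* Consider the facilitated totally asymmetric simple exclusion process (FTASEP) on $\mathbb{Z}$. (1) For $1/2<\rho<1$, there exists a family of (spatially) ergodic, non-degenerate probability measures on $\{0,1\}^{\mathbb{Z}}$ that are invariant for the FTASEP and have density $\rho$; that is, for every $\rho\in(1/2,1)$ there exists a translation invariant, spatially ergodic, non-degenerate probability measure of density $\rho$ that is invariant for the FTASEP. (2) For $0<\rho\le 1/2$, there is no translation invariant, spatially ergodic, non-degenerate probability measure on $\{0,1\}^{\mathbb{Z}}$ of density $\rho$ that is invariant for the FTASEP.
   Context: State space: $\mathbf{X}=\{0,1\}^{\mathbb{Z}}$ (product topology); for $\eta\in\mathbf{X}$, $\eta(x)=1$ means there is a particle at $x$ and $\eta(x)=0$ means there is a hole at $x$. FTASEP: the Feller Markov process $(\eta_t)_{t\ge 0}$ on $\mathbf{X}$ whose infinitesimal generator acts on cylinder functions $f$ (functions depending on finitely many coordinates) by $$\mathcal{L}f(\eta)=\sum_{x\in\mathbb{Z}}\eta(x-1)\eta(x)[1-\eta(x+1)]\,[f(\eta^{x,x+1})-f(\eta)],$$ where $\eta^{x,x+1}$ is obtained from $\eta$ by exchanging the values at $x$ and $x+1$. That is, a particle at $x$ jumps to $x+1$ at rate $1$ provided $x+1$ is empty and $x-1$ is occupied. Let $S(t)$ be its semigroup and $\mu S(t)$ the law at time $t$ when the initial law is $\mu$; $\mu$ is invariant for the process if $\mu S(t)=\mu$ for all $t\ge 0$. Shifts: $(\tau_x\eta)(y)=\eta(x+y)$, $(\tau_x f)(\eta)=f(\tau_x\eta)$,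 and $\int f\,d(\tau_x\mu)=\int \tau_x f\,d\mu$. A probability measure $\mu$ on $\mathbf{X}$ is translation invariant if $\tau_x\mu=\mu$ for all $x\in\mathbb{Z}$. A translation invariant $\mu$ is (spatially) ergodic if whenever $\tau_x f=f$ for all $x\in\mathbb{Z}$, $f$ is constant $\mu$-a.s. A translation invariant $\mu$ has density $\rho$ if $\mu\{\eta:\eta(x)=1\}=\rho$, and is degenerate if $\mu\{\eta:\eta(x)=\eta(x+1)=1\}=0$ (neither depends on $x$); it is non-degenerate otherwise. *)

theory Defs
  imports "HOL-Probability.Probability"
begin

text \<open>A configuration \<open>\<eta>\<close> has a particle at \<open>x\<close> iff \<open>\<eta> x\<close>. The instances for functions and
  for \<^typ>\<open>bool\<close> make this the space of 0-1 sequences indexed by \<^typ>\<open>int\<close> with the product of the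
  discrete topologies; measures on it live on its Borel sigma-algebra.\<close>

type_synonym config = "int \<Rightarrow> bool"

definition prob_on :: "config measure \<Rightarrow> bool" where
  "prob_on \<mu> \<longleftrightarrow> prob_space \<mu> \<and> sets \<mu> = sets borel"

definition cylinder :: "(config \<Rightarrow> real) \<Rightarrow> bool" where
  "cylinder f \<longleftrightarrow> (\<exists>A. finite A \<and> (\<forall>\<eta> \<zeta>. (\<forall>x\<in>A. \<eta> x = \<zeta> x) \<longrightarrow> f \<eta> = f \<zeta>))"

definition exchange :: "int \<Rightarrow> config \<Rightarrow> config" where
  "exchange x \<eta> = \<eta>(x := \<eta> (x + 1), x + 1 := \<eta> x)"

text \<open>For a cylinder function only finitely many terms of the sum are nonzero.\<close>

definition ftasep_generator :: "(config \<Rightarrow> real) \<Rightarrow> config \<Rightarrow> real" where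
  "ftasep_generator f \<eta> =
     (\<Sum>\<^sub>\<infinity>x\<in>UNIV. of_bool (\<eta> (x - 1)) * of_bool (\<eta> x) * (1 - of_bool (\<eta> (x + 1)))
        * (f (exchange x \<eta>) - f \<eta>))"

text \<open>A process is given by its transition kernels: \<open>P t \<eta>\<close> is the law at time \<open>t \<ge> 0\<close> of
  the process started from \<open>\<eta>\<close> (values of \<open>P\<close> at negative times are irrelevant).\<close>

definition transition_op :: "(real \<Rightarrow> config \<Rightarrow> config measure) \<Rightarrow> real \<Rightarrow> (config \<Rightarrow> real) \<Rightarrow> config \<Rightarrow> real" where
  "transition_op P t f \<eta> = (\<integral>\<zeta>. f \<zeta> \<partial>P t \<eta>)"

definition feller_process :: "(real \<Rightarrow> config \<Rightarrow> config measure) \<Rightarrow> bool" where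
  "feller_process P \<longleftrightarrow>
     (\<forall>t\<ge>0. P t \<in> borel \<rightarrow>\<^sub>M prob_algebra borel) \<and>
     (\<forall>\<eta>. P 0 \<eta> = return borel \<eta>) \<and>
     (\<forall>s\<ge>0. \<forall>t\<ge>0. \<forall>\<eta>. P (s + t) \<eta> = P s \<eta> \<bind> P t) \<and>
     (\<forall>f. continuous_on UNIV f \<longrightarrow>
        (\<forall>t\<ge>0. continuous_on UNIV (transition_op P t f)) \<and>
        uniform_limit UNIV (\<lambda>t. transition_op P t f) f (at_right 0))"

text \<open>\<open>f\<close> is in the domain of the infinitesimal generator, which maps it to \<open>g\<close>; the limit is
  in the sup norm on the continuous functions.\<close>

definition generator_maps ::
    "(real \<Rightarrow> config \<Rightarrow> config measure) \<Rightarrow> (config \<Rightarrow> real) \<Rightarrow> (config \<Rightarrow> real) \<Rightarrow> bool" where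
  "generator_maps P f g \<longleftrightarrow> continuous_on UNIV f \<and> continuous_on UNIV g \<and>
     uniform_limit UNIV (\<lambda>t \<eta>. (transition_op P t f \<eta> - f \<eta>) / t) g (at_right 0)"

text \<open>Among Feller processes these conditions determine \<open>P t\<close> for \<open>t \<ge> 0\<close>, because the cylinder
  functions form a core (Liggett, Interacting Particle Systems, Theorem I.3.9).\<close>

definition ftasep :: "(real \<Rightarrow> config \<Rightarrow> config measure) \<Rightarrow> bool" where
  "ftasep P \<longleftrightarrow> feller_process P \<and>
     (\<forall>f. cylinder f \<longrightarrow> generator_maps P f (ftasep_generator f))"

definition law_at :: "(real \<Rightarrow> config \<Rightarrow> config measure) \<Rightarrow> config measure \<Rightarrow> real \<Rightarrow> config measure" where
  "law_at P \<mu> t = \<mu> \<bind> P t"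

definition invariant_for :: "(real \<Rightarrow> config \<Rightarrow> config measure) \<Rightarrow> config measure \<Rightarrow> bool" where
  "invariant_for P \<mu> \<longleftrightarrow> (\<forall>t\<ge>0. law_at P \<mu> t = \<mu>)"

definition shift_config :: "int \<Rightarrow> config \<Rightarrow> config" where
  "shift_config x \<eta> = (\<lambda>y. \<eta> (x + y))"

definition translation_invariant :: "config measure \<Rightarrow> bool" where
  "translation_invariant \<mu> \<longleftrightarrow> (\<forall>x. distr \<mu> borel (shift_config x) = \<mu>)"

definition spatially_ergodic :: "config measure \<Rightarrow> bool" where
  "spatially_ergodic \<mu> \<longleftrightarrow> translation_invariant \<mu> \<and>
     (\<forall>f :: config \<Rightarrow> real. f \<in> borel_measurable borel \<longrightarrow> (\<forall>x. f \<circ> shift_config x = f) \<longrightarrow>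
        (\<exists>c. AE \<eta> in \<mu>. f \<eta> = c))"

text \<open>The next two notions are used for translation invariant measures, where the
  probabilities do not depend on the site.\<close>

definition has_density :: "config measure \<Rightarrow> real \<Rightarrow> bool" where
  "has_density \<mu> \<rho> \<longleftrightarrow> (\<forall>x. measure \<mu> {\<eta>. \<eta> x} = \<rho>)"

definition degenerate :: "config measure \<Rightarrow> bool" where
  "degenerate \<mu> \<longleftrightarrow> (\<forall>x. measure \<mu> {\<eta>. \<eta> x \<and> \<eta> (x + 1)} = 0)"

end

theory Submission
  imports Defs
begin

text \<open>
  Everything rests on a description of invariance by the generator \<open>L\<close> alone: \<open>\<mu>\<close> is invariant iff
  \<open>\<integral> L f d\<mu> = 0\<close> for all cylinder functions \<open>f\<close>. One direction is differentiation at time \<open>0\<close>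
  (\<open>generator_zero_if_invariant\<close>). For the other, cylinder functions are analytic vectors: the norm of
  \<open>L\<^sup>k f\<close> is at most of order \<open>8\<^sup>k k!\<close> up to a polynomial factor in \<open>k\<close>,
  so for small \<open>t\<close> the remainders in the Taylor expansion of \<open>\<integral> f d(\<mu> S(t))\<close> tend to \<open>0\<close>, and all its higher coefficients vanish
  (\<open>invariant_if_generator_zero\<close>).

  Density \<open>\<rho> \<le> 1 / 2\<close>. Jumps never create two adjacent holes. Stationarity of the probability of \<open>00\<close>
  therefore forces \<open>1100\<close> to have probability \<open>0\<close>, and inductively every word \<open>1(10)\<^sup>k0\<close>
  with \<open>k > 0\<close>, because each such word turns by one jump into one that contains the previous one (\<open>AE_no_word\<close>). Hence
  almost surely no pair of holes has a pair of particles on its left. But non-degeneracy and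
  \<open>\<rho> \<le> 1 / 2\<close> give both kinds of pairs positive probability, and then ergodicity and recurrence give
  both, in this order, almost surely (\<open>no_invariant_low_density\<close>).

  Density \<open>\<rho> > 1 / 2\<close>. The invariant measure is the stationary Markov chain on \<open>{0, 1}\<close> in which a hole is
  always followed by a particle and a particle is followed by a hole with probability \<open>1 / \<rho> - 1\<close>.
  It is realised as a shift-commuting function \<open>fill\<close> of independent coins, from which it inherits
  mixing and thus ergodicity. A jump of a particle corresponds to a cyclic permutation of three
  coins (\<open>rotate_coins_jump\<close>), which preserves the law of the coins; so the gain into a configuration
  counts its patterns \<open>1011\<close>, and the loss counts its patterns \<open>110\<close>. The difference of the two is a
  discrete gradient (\<open>jump_telescopes\<close>), so \<open>\<integral> L f d\<mu>\<close> is a difference of boundary terms, one far to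
  the left and one far to the right of the sites on which \<open>f\<close> depends, and mixing shows that it
  vanishes (\<open>generator_integral_filled\<close>).
\<close>

section \<open>Cylinder functions and iterates of the generator\<close>

text \<open>With this instance the Borel sets of configurations are the product sigma-algebra.\<close>

instance bool :: second_countable_topology
proof
  have "open (U :: bool set)" for U by (rule Topological_Spaces.open_discrete)
  moreover have "generate_topology UNIV (U :: bool set)" for U
    by (rule generate_topology.Basis) simp
  ultimately have "(open :: bool set \<Rightarrow> bool) = generate_topology UNIV" by (simp add: fun_eq_iff)
  then show "\<exists>B::bool set set. countable B \<and> open = generate_topology B"
    by (intro exI[of _ UNIV]) simp
qed

lemma sets_config: "sets (borel :: config measure) = sets (Pi\<^sub>M UNIV (\<lambda>_. borel :: bool measure))"
  by (simp add: sets_PiM_equal_borel)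

lemma measurable_site [measurable]: "(\<lambda>\<eta>::config. \<eta> x) \<in> borel \<rightarrow>\<^sub>M count_space UNIV"
proof -
  have "(\<lambda>\<eta>::config. \<eta> x) \<in> Pi\<^sub>M UNIV (\<lambda>_. borel :: bool measure) \<rightarrow>\<^sub>M borel"
    by measurable
  then show ?thesis
    by (simp add: measurable_def sets_config sets_borel_eq_count_space space_PiM)
qed

lemma measurable_config_map:
  assumes "\<And>x. (\<lambda>\<omega>. F \<omega> x) \<in> M \<rightarrow>\<^sub>M count_space UNIV"
  shows "F \<in> M \<rightarrow>\<^sub>M (borel :: config measure)"
proof (rule measurable_coordinatewise_then_product)
  fix x
  show "(\<lambda>\<omega>. F \<omega> x) \<in> borel_measurable M"
    using assms[of x] measurable_cong_sets[of M M "borel :: bool measure" "count_space UNIV"]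
      sets_borel_eq_count_space[where 'a = bool] by simp
qed

lemma measurable_shift [measurable]: "shift_config x \<in> borel \<rightarrow>\<^sub>M borel"
  by (rule measurable_config_map) (simp add: shift_config_def)

definition depends_on :: "int set \<Rightarrow> (config \<Rightarrow> 'a) \<Rightarrow> bool" where
  "depends_on A f \<longleftrightarrow> (\<forall>\<eta> \<zeta>. (\<forall>x\<in>A. \<eta> x = \<zeta> x) \<longrightarrow> f \<eta> = f \<zeta>)"

definition window :: "nat \<Rightarrow> int set" where
  "window n = {- int n..int n}"

lemma depends_onD: "depends_on A f \<Longrightarrow> (\<And>x. x \<in> A \<Longrightarrow> \<eta> x = \<zeta> x) \<Longrightarrow> f \<eta> = f \<zeta>"
  by (auto simp: depends_on_def)

lemma depends_on_mono: "depends_on A f \<Longrightarrow> A \<subseteq> B \<Longrightarrow> depends_on B f"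
  by (auto simp: depends_on_def subset_eq)

lemma finite_subset_window:
  assumes "finite A" shows "\<exists>n. A \<subseteq> window n"
proof -
  define n where "n = (\<Sum>x\<in>A. nat \<bar>x\<bar>)"
  have "x \<in> window n" if "x \<in> A" for x
  proof -
    have "nat \<bar>x\<bar> \<le> n"
      unfolding n_def using assms that by (intro member_le_sum) auto
    then show ?thesis by (simp add: window_def) linarith
  qed
  then show ?thesis by blast
qed

lemma cylinder_iff: "cylinder f \<longleftrightarrow> (\<exists>A. finite A \<and> depends_on A f)"
  by (auto simp: cylinder_def depends_on_def)

lemma cylinder_window: "cylinder f \<longleftrightarrow> (\<exists>n. depends_on (window n) f)"
  unfolding cylinder_iff
  by (metis depends_on_mono finite_atLeastAtMost_int finite_subset_window window_def)

text \<open>A function of the sites in \<open>A\<close> is determined by its values on the configurations that vanish off \<open>A\<close>.\<close>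

lemma finite_range_depends_on:
  assumes "finite A" "depends_on A f"
  shows "finite (range f)"
proof -
  have "range f \<subseteq> (\<lambda>S. f (\<lambda>x. x \<in> S)) ` Pow A"
  proof
    fix y assume "y \<in> range f"
    then obtain \<eta> where "y = f \<eta>" by auto
    also have "f \<eta> = f (\<lambda>x. x \<in> {x \<in> A. \<eta> x})"
      by (rule depends_onD[OF assms(2)]) auto
    finally show "y \<in> (\<lambda>S. f (\<lambda>x. x \<in> S)) ` Pow A" by blast
  qed
  then show ?thesis using assms(1) by (meson finite_Pow_iff finite_imageI finite_subset)
qed

lemma cylinder_finite_range: "cylinder f \<Longrightarrow> finite (range f)"
  unfolding cylinder_iff using finite_range_depends_on by blast

lemma cylinder_bounded:
  assumes "cylinder f" shows "\<exists>C\<ge>0. \<forall>\<eta>. \<bar>f \<eta>\<bar> \<le> C"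
proof -
  have fin: "finite (range (\<lambda>\<eta>. \<bar>f \<eta>\<bar>))"
    using cylinder_finite_range[OF assms]
    by (metis finite_imageI image_image)
  have le: "\<bar>f \<eta>\<bar> \<le> Max (range (\<lambda>\<eta>. \<bar>f \<eta>\<bar>))" for \<eta>
    using fin by (intro Max_ge) auto
  then show ?thesis using abs_ge_zero order_trans by blast
qed

definition jump_allowed :: "int \<Rightarrow> config \<Rightarrow> bool" where
  "jump_allowed x \<eta> \<longleftrightarrow> \<eta> (x - 1) \<and> \<eta> x \<and> \<not> \<eta> (x + 1)"

lemma generator_eq_sum:
  assumes f: "depends_on {a..b} f" and A: "finite A" "{a - 1..b} \<subseteq> A"
  shows "ftasep_generator f \<eta> = (\<Sum>x\<in>A. of_bool (jump_allowed x \<eta>) * (f (exchange x \<eta>) - f \<eta>))"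
proof -
  have *: "f (exchange x \<eta>) = f \<eta>" if "x \<notin> A" for x
    by (rule depends_onD[OF f]) (use that A in \<open>auto simp: exchange_def subset_eq\<close>)
  have "ftasep_generator f \<eta>
    = (\<Sum>\<^sub>\<infinity>x\<in>A. of_bool (jump_allowed x \<eta>) * (f (exchange x \<eta>) - f \<eta>))"
    unfolding ftasep_generator_def
    by (rule infsum_cong_neutral) (auto simp: jump_allowed_def *)
  then show ?thesis using A by simp
qed

text \<open>Only a jump that starts in the window or one site to its left can change \<open>f\<close>, so the generator
  is a sum of \<open>2n + 2\<close> terms. Its norm on functions of \<open>window n\<close> is therefore linear in \<open>n\<close>, while the
  window grows only by two sites.\<close>

lemma generator_window:
  assumes f: "depends_on (window n) f"
  shows "depends_on (window (n + 2)) (ftasep_generator f)"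
    and "(\<And>\<eta>. \<bar>f \<eta>\<bar> \<le> C) \<Longrightarrow> \<bar>ftasep_generator f \<eta>\<bar> \<le> 4 * (real n + 1) * C"
proof -
  define A where "A = {- int n - 1..int n}"
  have eq: "ftasep_generator f \<eta> = (\<Sum>x\<in>A. of_bool (jump_allowed x \<eta>) * (f (exchange x \<eta>) - f \<eta>))" for \<eta>
    by (rule generator_eq_sum[of "- int n" "int n"]) (use f in \<open>auto simp: A_def window_def\<close>)
  show "depends_on (window (n + 2)) (ftasep_generator f)"
    unfolding depends_on_def
  proof (intro allI impI)
    fix \<eta> \<zeta> :: config assume *: "\<forall>x\<in>window (n + 2). \<eta> x = \<zeta> x"
    then have **: "\<eta> x = \<zeta> x" if "- int n - 2 \<le> x" "x \<le> int n + 2" for x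
      using that by (auto simp: window_def)
    have "jump_allowed x \<eta> = jump_allowed x \<zeta>" "f (exchange x \<eta>) = f (exchange x \<zeta>)"
      if "x \<in> A" for x
      using that by (auto simp: jump_allowed_def ** A_def exchange_def window_def intro!: depends_onD[OF f])
    moreover have "f \<eta> = f \<zeta>" by (rule depends_onD[OF f]) (auto simp: ** window_def)
    ultimately show "ftasep_generator f \<eta> = ftasep_generator f \<zeta>"
      unfolding eq by (intro sum.cong) auto
  qed
  assume C: "\<And>\<eta>. \<bar>f \<eta>\<bar> \<le> C"
  have "\<bar>ftasep_generator f \<eta>\<bar> \<le> (\<Sum>x\<in>A. \<bar>of_bool (jump_allowed x \<eta>) * (f (exchange x \<eta>) - f \<eta>)\<bar>)"
    unfolding eq by (rule sum_abs)
  also have "\<dots> \<le> (\<Sum>x\<in>A. 2 * C)"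
  proof (rule sum_mono)
    fix x
    show "\<bar>of_bool (jump_allowed x \<eta>) * (f (exchange x \<eta>) - f \<eta>)\<bar> \<le> 2 * C"
      using C[of \<eta>] C[of "exchange x \<eta>"] by (cases "jump_allowed x \<eta>") auto
  qed
  also have "\<dots> = 4 * (real n + 1) * C" by (simp add: A_def algebra_simps)
  finally show "\<bar>ftasep_generator f \<eta>\<bar> \<le> 4 * (real n + 1) * C" .
qed

lemma cylinder_generator: "cylinder f \<Longrightarrow> cylinder (ftasep_generator f)"
  using generator_window(1) cylinder_window by blast

text \<open>Because of this linear growth the \<open>k\<close>-th iterate is at most of order \<open>8\<^sup>k k!\<close>, with a
  polynomial correction in \<open>k\<close>. The exponential series \<open>\<Sum>k. t\<^sup>k L\<^sup>k f / k!\<close> then has a positive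
  radius of convergence that is the same for all cylinder functions: they are analytic vectors.\<close>

lemma generator_iterate_bound:
  assumes f: "depends_on (window n) f" and C: "\<And>\<eta>. \<bar>f \<eta>\<bar> \<le> C"
  shows "depends_on (window (n + 2 * k)) ((ftasep_generator ^^ k) f) \<and>
    (\<forall>\<eta>. \<bar>(ftasep_generator ^^ k) f \<eta>\<bar> \<le> 8 ^ k * fact (n + k) * C)"
proof (induction k)
  case 0
  have "0 \<le> C" using C[of undefined] by simp
  moreover have "1 \<le> (fact n :: real)" by (rule fact_ge_1)
  ultimately have "C \<le> fact n * C" by (simp add: mult_le_cancel_right1)
  then show ?case using f C order_trans by auto
next
  case (Suc k)
  let ?g = "(ftasep_generator ^^ k) f" and ?D = "8 ^ k * fact (n + k) * C"
  have "0 \<le> C" using C[of undefined] by simp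
  have "\<bar>ftasep_generator ?g \<eta>\<bar> \<le> 8 ^ Suc k * fact (n + Suc k) * C" for \<eta>
  proof -
    have "\<bar>ftasep_generator ?g \<eta>\<bar> \<le> 4 * (real (n + 2 * k) + 1) * ?D"
      using Suc.IH by (intro generator_window(2)) auto
    also have "\<dots> \<le> 8 * (real (n + k) + 1) * ?D"
      using \<open>0 \<le> C\<close> by (intro mult_right_mono) auto
    also have "\<dots> = 8 ^ Suc k * fact (n + Suc k) * C" by (simp add: algebra_simps)
    finally show ?thesis .
  qed
  moreover have "depends_on (window (n + 2 * k + 2)) (ftasep_generator ?g)"
    using Suc.IH by (intro generator_window(1)) auto
  ultimately show ?case by simp
qed

lemma config_measure_eqI:
  assumes \<mu>: "prob_on \<mu>" and \<nu>: "prob_on \<nu>"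
    and eq: "\<And>f. cylinder f \<Longrightarrow> (\<integral>\<eta>. f \<eta> \<partial>\<mu>) = (\<integral>\<eta>. f \<eta> \<partial>\<nu>)"
  shows "\<mu> = \<nu>"
proof (rule measure_eqI_PiM_infinite)
  interpret \<mu>: prob_space \<mu> using \<mu> by (simp add: prob_on_def)
  interpret \<nu>: prob_space \<nu> using \<nu> by (simp add: prob_on_def)
  show "finite_measure \<mu>" by (rule \<mu>.finite_measure_axioms)
  have s: "sets \<mu> = sets borel" "sets \<nu> = sets borel" using \<mu> \<nu> by (auto simp: prob_on_def)
  show s': "sets \<mu> = sets (Pi\<^sub>M UNIV (\<lambda>_. borel))" "sets \<nu> = sets (Pi\<^sub>M UNIV (\<lambda>_. borel))"
    using s sets_config by auto
  fix A :: "int \<Rightarrow> bool set" and J :: "int set"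
  assume J: "finite J" and A: "\<And>i. i \<in> J \<Longrightarrow> A i \<in> sets borel"
  let ?X = "prod_emb UNIV (\<lambda>_. borel) J (Pi\<^sub>E J A)"
  have X: "?X \<in> sets borel" unfolding sets_config using J A by (intro sets_PiM_I) auto
  have "depends_on J (indicator ?X :: config \<Rightarrow> real)"
    by (auto simp: depends_on_def prod_emb_def indicator_def PiE_iff extensional_def)
  then have "cylinder (indicator ?X)" using J cylinder_iff by blast
  from eq[OF this] have "measure \<mu> ?X = measure \<nu> ?X"
    using s X by (simp add: \<mu>.emeasure_eq_measure \<nu>.emeasure_eq_measure)
  then show "emeasure \<mu> ?X = emeasure \<nu> ?X"
    by (simp add: \<mu>.emeasure_eq_measure \<nu>.emeasure_eq_measure)
qed

section \<open>Invariance in terms of the generator\<close>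

lemma prob_onD:
  assumes "prob_on \<mu>"
  shows "prob_space \<mu>" "sets \<mu> = sets borel" "space \<mu> = UNIV"
  using assms sets_eq_imp_space_eq[of \<mu> borel] by (auto simp: prob_on_def)

lemma prob_on_in_prob_algebra: "prob_on \<mu> \<Longrightarrow> \<mu> \<in> space (prob_algebra borel)"
  by (simp add: prob_on_def space_prob_algebra)

lemma prob_on_integrable:
  fixes f :: "config \<Rightarrow> real"
  assumes \<mu>: "prob_on \<mu>" and "f \<in> borel_measurable borel" and "\<And>\<eta>. \<bar>f \<eta>\<bar> \<le> C"
  shows "integrable \<mu> f"
proof -
  interpret prob_space \<mu> using \<mu> by (rule prob_onD)
  show ?thesis
    by (rule integrable_const_bound[of _ C])
      (use assms prob_onD(2)[OF \<mu>] in \<open>auto simp: measurable_cong_sets[OF prob_onD(2)[OF \<mu>] refl]\<close>)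
qed

lemma prob_on_integral_le:
  fixes f :: "config \<Rightarrow> real"
  assumes \<mu>: "prob_on \<mu>" and f: "f \<in> borel_measurable borel" and C: "\<And>\<eta>. \<bar>f \<eta>\<bar> \<le> C"
  shows "\<bar>\<integral>\<eta>. f \<eta> \<partial>\<mu>\<bar> \<le> C"
proof -
  interpret prob_space \<mu> using \<mu> by (rule prob_onD)
  have int: "integrable \<mu> f" by (rule prob_on_integrable[OF assms])
  have "\<bar>\<integral>\<eta>. f \<eta> \<partial>\<mu>\<bar> \<le> (\<integral>\<eta>. \<bar>f \<eta>\<bar> \<partial>\<mu>)" by (rule integral_abs_bound)
  also have "\<dots> \<le> (\<integral>\<eta>. C \<partial>\<mu>)" using int C by (intro integral_mono) auto
  finally show ?thesis by (simp add: prob_space)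
qed

context
  fixes P :: "real \<Rightarrow> config \<Rightarrow> config measure"
  assumes P: "ftasep P"
begin

lemma kernel_measurable: "0 \<le> t \<Longrightarrow> P t \<in> borel \<rightarrow>\<^sub>M prob_algebra borel"
  using P by (simp add: ftasep_def feller_process_def)

lemma kernel_prob_on: "0 \<le> t \<Longrightarrow> prob_on (P t \<eta>)"
  using measurable_space[OF kernel_measurable, of t \<eta>] by (auto simp: prob_on_def space_prob_algebra)

lemma kernel_measurable_subprob:
  assumes "0 \<le> t" "prob_on \<mu>"
  shows "P t \<in> \<mu> \<rightarrow>\<^sub>M subprob_algebra borel"
  using measurable_prob_algebraD[OF kernel_measurable[OF assms(1)]]
  by (simp add: measurable_cong_sets[OF prob_onD(2)[OF assms(2)] refl])

lemma prob_on_law_at: "0 \<le> t \<Longrightarrow> prob_on \<mu> \<Longrightarrow> prob_on (law_at P \<mu> t)"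
  using prob_space_bind'[OF prob_on_in_prob_algebra kernel_measurable, of \<mu> t]
    sets_bind'[OF prob_on_in_prob_algebra kernel_measurable, of \<mu> t]
  by (simp add: prob_on_def law_at_def)

lemma law_at_0: "prob_on \<mu> \<Longrightarrow> law_at P \<mu> 0 = \<mu>"
proof -
  assume \<mu>: "prob_on \<mu>"
  have "P 0 = return borel"
    using P by (auto simp: ftasep_def feller_process_def)
  then show ?thesis using \<mu> by (simp add: law_at_def bind_return'' prob_onD)
qed

lemma law_at_add:
  assumes "0 \<le> s" "0 \<le> t" "prob_on \<mu>"
  shows "law_at P \<mu> (s + t) = law_at P (law_at P \<mu> s) t"
proof -
  have "P (s + t) = (\<lambda>\<eta>. P s \<eta> \<bind> P t)"
    using P assms by (auto simp: ftasep_def feller_process_def)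
  then show ?thesis
    unfolding law_at_def
    using bind_assoc[OF kernel_measurable_subprob[OF assms(1,3)] measurable_prob_algebraD[OF kernel_measurable[OF assms(2)]]]
    by simp
qed

lemma cylinder_continuous: "cylinder f \<Longrightarrow> continuous_on UNIV f"
  using P by (auto simp: ftasep_def generator_maps_def)

lemma cylinder_measurable: "cylinder f \<Longrightarrow> f \<in> borel_measurable borel"
  by (intro borel_measurable_continuous_onI cylinder_continuous)

lemma transition_op_measurable:
  assumes "cylinder f" "0 \<le> t" shows "transition_op P t f \<in> borel_measurable borel"
  using P assms cylinder_continuous
  by (intro borel_measurable_continuous_onI) (auto simp: ftasep_def feller_process_def)

lemma transition_op_bound:
  assumes "cylinder f" "0 \<le> t" "\<And>\<eta>. \<bar>f \<eta>\<bar> \<le> C" shows "\<bar>transition_op P t f \<eta>\<bar> \<le> C"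
  unfolding transition_op_def
  using assms by (intro prob_on_integral_le kernel_prob_on cylinder_measurable)

lemma integral_law_at:
  assumes t: "0 \<le> t" and \<mu>: "prob_on \<mu>" and f: "cylinder f"
  shows "(\<integral>\<eta>. f \<eta> \<partial>law_at P \<mu> t) = (\<integral>\<eta>. transition_op P t f \<eta> \<partial>\<mu>)"
proof -
  interpret prob_space \<mu> using \<mu> by (rule prob_onD)
  obtain C where C: "\<And>\<eta>. \<bar>f \<eta>\<bar> \<le> C" using cylinder_bounded[OF f] by blast
  have "emeasure (P t \<eta>) (space (P t \<eta>)) \<le> ennreal 1" for \<eta>
    using prob_space.emeasure_space_1[OF prob_onD(1)[OF kernel_prob_on[OF t]]] by simp
  then show ?thesis
    unfolding law_at_def transition_op_def
    by (intro integral_bind[where B = C and B' = 1 and K = borel])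
      (use C cylinder_measurable[OF f] kernel_measurable_subprob[OF t \<mu>] in \<open>auto simp: finite_measure_axioms\<close>)
qed

text \<open>The generator limit is uniform in the configuration, so the first-order expansion in \<open>h\<close> holds
  with one \<open>\<delta>\<close> for all initial laws \<open>\<nu>\<close>. Applied to the law at a time \<open>s\<close> it controls the increment
  from \<open>s\<close> to \<open>s + h\<close>, uniformly in \<open>s\<close>.\<close>

lemma law_at_increment:
  assumes f: "cylinder f" and "0 < \<epsilon>"
  shows "\<exists>\<delta>>0. \<forall>h \<nu>. 0 < h \<longrightarrow> h < \<delta> \<longrightarrow> prob_on \<nu> \<longrightarrow>
    \<bar>(\<integral>\<eta>. f \<eta> \<partial>law_at P \<nu> h) - (\<integral>\<eta>. f \<eta> \<partial>\<nu>) - h * (\<integral>\<eta>. ftasep_generator f \<eta> \<partial>\<nu>)\<bar> \<le> \<epsilon> * h"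
proof -
  let ?L = "ftasep_generator f"
  have "uniform_limit UNIV (\<lambda>t \<eta>. (transition_op P t f \<eta> - f \<eta>) / t) ?L (at_right 0)"
    using P f by (auto simp: ftasep_def generator_maps_def)
  then have "\<forall>\<^sub>F t in at_right 0. \<forall>\<eta>\<in>UNIV. dist ((transition_op P t f \<eta> - f \<eta>) / t) (?L \<eta>) < \<epsilon>"
    using \<open>0 < \<epsilon>\<close> by (rule uniform_limitD)
  then obtain \<delta> where \<delta>: "0 < \<delta>"
    "\<And>t \<eta>. 0 < t \<Longrightarrow> t < \<delta> \<Longrightarrow> dist ((transition_op P t f \<eta> - f \<eta>) / t) (?L \<eta>) < \<epsilon>"
    unfolding eventually_at_right_field by auto
  have "\<bar>(\<integral>\<eta>. f \<eta> \<partial>law_at P \<nu> h) - (\<integral>\<eta>. f \<eta> \<partial>\<nu>) - h * (\<integral>\<eta>. ?L \<eta> \<partial>\<nu>)\<bar> \<le> \<epsilon> * h"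
    if h: "0 < h" "h < \<delta>" and \<nu>: "prob_on \<nu>" for h \<nu>
  proof -
    obtain C where C: "\<And>\<eta>. \<bar>f \<eta>\<bar> \<le> C" using cylinder_bounded[OF f] by blast
    obtain D where D: "\<And>\<eta>. \<bar>?L \<eta>\<bar> \<le> D"
      using cylinder_bounded[OF cylinder_generator[OF f]] by blast
    note meas = cylinder_measurable[OF f] cylinder_measurable[OF cylinder_generator[OF f]]
      transition_op_measurable[OF f, of h]
    have int: "integrable \<nu> f" "integrable \<nu> ?L" "integrable \<nu> (transition_op P h f)"
      using h transition_op_bound[OF f _ C, of h] C D
      by (auto intro!: prob_on_integrable[OF \<nu>] meas)
    have "\<bar>transition_op P h f \<eta> - f \<eta> - h * ?L \<eta>\<bar> \<le> \<epsilon> * h" for \<eta>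
    proof -
      have "\<bar>transition_op P h f \<eta> - f \<eta> - h * ?L \<eta>\<bar>
          = \<bar>(transition_op P h f \<eta> - f \<eta>) / h - ?L \<eta>\<bar> * h"
      proof -
        have "transition_op P h f \<eta> - f \<eta> - h * ?L \<eta> = ((transition_op P h f \<eta> - f \<eta>) / h - ?L \<eta>) * h"
          using h by (simp add: field_simps)
        then show ?thesis using h by (simp only: abs_mult abs_of_pos)
      qed
      also have "\<dots> \<le> \<epsilon> * h"
        using \<delta>(2)[OF h, of \<eta>] h by (intro mult_right_mono) (auto simp: dist_real_def)
      finally show ?thesis .
    qed
    then have "\<bar>\<integral>\<eta>. transition_op P h f \<eta> - f \<eta> - h * ?L \<eta> \<partial>\<nu>\<bar> \<le> \<epsilon> * h"
      using h by (intro prob_on_integral_le[OF \<nu>] borel_measurable_diff borel_measurable_times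
          borel_measurable_const meas) auto
    then show ?thesis using int h integral_law_at[OF _ \<nu> f, of h] by simp
  qed
  then show ?thesis using \<delta>(1) by blast
qed

end

text \<open>A discrete integration: \<open>u\<close> has derivative \<open>v\<close> up to errors that are uniform in time, so a
  bound on \<open>v\<close> may be integrated along the grid of multiples of \<open>t / N\<close>.\<close>

lemma growth_bound_step:
  fixes u v :: "real \<Rightarrow> real"
  assumes incr: "\<And>\<epsilon>. 0 < \<epsilon> \<Longrightarrow> \<exists>\<delta>>0. \<forall>h s. 0 < h \<longrightarrow> h < \<delta> \<longrightarrow> 0 \<le> s \<longrightarrow> \<bar>u (s + h) - u s - h * v s\<bar> \<le> \<epsilon> * h"
    and v: "\<And>s. 0 \<le> s \<Longrightarrow> \<bar>v s\<bar> \<le> D * s ^ k / fact k" and D: "0 \<le> D" and t: "0 \<le> t"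
  shows "\<bar>u t - u 0\<bar> \<le> D * t ^ Suc k / fact (Suc k)"
proof (cases "t = 0")
  case False
  then have t: "0 < t" using t by simp
  \<comment> \<open>One grid step of the integral of the power function, estimated by convexity.\<close>
  have bern: "a ^ Suc k + real (Suc k) * a ^ k * h \<le> (a + h) ^ Suc k" if "0 \<le> a" "0 < h" for a h :: real
  proof -
    have "a ^ n + real n * a ^ (n - 1) * h \<le> (a + h) ^ n" for n
    proof (induction n)
      case (Suc n)
      have "a ^ Suc n + real (Suc n) * a ^ n * h \<le> (a + h) * (a ^ n + real n * a ^ (n - 1) * h)"
        using that by (cases n) (auto simp: algebra_simps)
      also have "\<dots> \<le> (a + h) * (a + h) ^ n" using that Suc by (intro mult_left_mono) auto
      finally show ?case by simp
    qed simp
    from this[of "Suc k"] show ?thesis by simp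
  qed
  show ?thesis
  proof (rule field_le_epsilon)
    fix e :: real assume "0 < e"
    then have "0 < e / t" using t by simp
    from incr[OF this] obtain \<delta> where \<delta>: "0 < \<delta>"
      "\<And>h s. 0 < h \<Longrightarrow> h < \<delta> \<Longrightarrow> 0 \<le> s \<Longrightarrow> \<bar>u (s + h) - u s - h * v s\<bar> \<le> e / t * h" by blast
    obtain N where N: "t / \<delta> < real N" using reals_Archimedean2 by blast
    have "0 < t / \<delta>" using t \<delta> by simp
    then have "0 < real N" using N by linarith
    define h where "h = t / real N"
    have h: "0 < h" "h < \<delta>" using t \<open>0 < real N\<close> N \<delta> by (auto simp: h_def field_simps)
    have "\<bar>u (real j * h) - u 0\<bar> \<le> D * (real j * h) ^ Suc k / fact (Suc k) + e / t * (real j * h)" for j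
    proof (induction j)
      case (Suc j)
      let ?a = "real j * h"
      have a: "0 \<le> ?a" using h by simp
      have "\<bar>u (?a + h) - u 0\<bar> \<le> \<bar>u ?a - u 0\<bar> + h * \<bar>v ?a\<bar> + \<bar>u (?a + h) - u ?a - h * v ?a\<bar>"
      proof -
        have "\<bar>h * v ?a\<bar> = h * \<bar>v ?a\<bar>" using h by (simp add: abs_mult)
        then show ?thesis by linarith
      qed
      also have "\<dots> \<le> (D * ?a ^ Suc k / fact (Suc k) + e / t * ?a) + h * (D * ?a ^ k / fact k) + e / t * h"
        using Suc v[OF a] \<delta>(2)[OF h a] h by (intro add_mono mult_left_mono) auto
      also have "\<dots> = D / fact (Suc k) * (?a ^ Suc k + real (Suc k) * ?a ^ k * h) + e / t * (?a + h)"
        using t by (simp add: divide_simps) (simp add: algebra_simps)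
      also have "\<dots> \<le> D / fact (Suc k) * (?a + h) ^ Suc k + e / t * (?a + h)"
        using bern[OF a h(1)] D by (intro add_right_mono mult_left_mono) auto
      finally have "\<bar>u (?a + h) - u 0\<bar> \<le> D * (?a + h) ^ Suc k / fact (Suc k) + e / t * (?a + h)"
        by (simp only: times_divide_eq_left)
      moreover have "real (Suc j) * h = ?a + h" by (simp add: algebra_simps)
      ultimately show ?case by (simp only:)
    qed (use D in simp)
    from this[of N] show "\<bar>u t - u 0\<bar> \<le> D * t ^ Suc k / fact (Suc k) + e"
      using \<open>0 < real N\<close> t by (simp add: h_def)
  qed
qed (use D in simp)

text \<open>Taylor expansion of \<open>t \<mapsto> \<integral> f d(\<mu> S(t))\<close> at \<open>0\<close>. Its derivative of order \<open>j\<close> is the integral of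
  \<open>L\<^sup>j f\<close> against the law at time \<open>t\<close>; at \<open>t = 0\<close> this vanishes for \<open>j \<ge> 1\<close>, since \<open>L\<^sup>j f\<close> is the
  generator applied to a cylinder function. Only the remainder of order \<open>k\<close> is left.\<close>

lemma law_at_taylor:
  assumes P: "ftasep P" and \<mu>: "prob_on \<mu>"
    and gen: "\<And>f. cylinder f \<Longrightarrow> (\<integral>\<eta>. ftasep_generator f \<eta> \<partial>\<mu>) = 0"
    and "cylinder f" "0 \<le> t" "0 \<le> C" "\<And>\<eta>. \<bar>(ftasep_generator ^^ k) f \<eta>\<bar> \<le> C"
  shows "\<bar>(\<integral>\<eta>. f \<eta> \<partial>law_at P \<mu> t) - (\<integral>\<eta>. f \<eta> \<partial>\<mu>)\<bar> \<le> 2 * C * t ^ k / fact k"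
  using assms(4-)
proof (induction k arbitrary: f t)
  case 0
  have "\<bar>\<integral>\<eta>. f \<eta> \<partial>\<nu>\<bar> \<le> C" if "prob_on \<nu>" for \<nu>
    using 0 cylinder_measurable[OF P] that by (intro prob_on_integral_le) auto
  from this[OF \<mu>] this[OF prob_on_law_at[OF P 0(2) \<mu>]] show ?case by simp
next
  case (Suc k)
  let ?L = "ftasep_generator f"
  define u v where "u s = (\<integral>\<eta>. f \<eta> \<partial>law_at P \<mu> s)" and "v s = (\<integral>\<eta>. ?L \<eta> \<partial>law_at P \<mu> s)" for s
  have "\<bar>u t - u 0\<bar> \<le> 2 * C * t ^ Suc k / fact (Suc k)"
  proof (rule growth_bound_step)
    fix \<epsilon> :: real assume "0 < \<epsilon>"
    from law_at_increment[OF P Suc.prems(1) this]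
    show "\<exists>\<delta>>0. \<forall>h s. 0 < h \<longrightarrow> h < \<delta> \<longrightarrow> 0 \<le> s \<longrightarrow> \<bar>u (s + h) - u s - h * v s\<bar> \<le> \<epsilon> * h"
      unfolding u_def v_def using law_at_add[OF P _ _ \<mu>] prob_on_law_at[OF P _ \<mu>]
      by (metis order_less_imp_le)
  next
    fix s :: real assume "0 \<le> s"
    have "\<bar>(\<integral>\<eta>. ?L \<eta> \<partial>law_at P \<mu> s) - (\<integral>\<eta>. ?L \<eta> \<partial>\<mu>)\<bar> \<le> 2 * C * s ^ k / fact k"
      using Suc.prems \<open>0 \<le> s\<close>
      by (intro Suc.IH cylinder_generator) (auto simp: funpow_swap1)
    then show "\<bar>v s\<bar> \<le> 2 * C * s ^ k / fact k" using gen[OF Suc.prems(1)] by (simp add: v_def)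
  qed (use Suc.prems in auto)
  then show ?case by (simp add: u_def law_at_0[OF P \<mu>])
qed

text \<open>The Taylor remainder of order \<open>k\<close> is at most a constant times \<open>(16 t)\<^sup>k\<close> by
  \<open>generator_iterate_bound\<close>, so it tends to \<open>0\<close> for \<open>t < 1 / 16\<close>.\<close>

lemma invariant_short_time:
  assumes P: "ftasep P" and \<mu>: "prob_on \<mu>"
    and gen: "\<And>f. cylinder f \<Longrightarrow> (\<integral>\<eta>. ftasep_generator f \<eta> \<partial>\<mu>) = 0"
    and t: "0 \<le> t" "t \<le> 1 / 32"
  shows "law_at P \<mu> t = \<mu>"
proof (rule config_measure_eqI[OF prob_on_law_at[OF P t(1) \<mu>] \<mu>])
  fix f :: "config \<Rightarrow> real" assume f: "cylinder f"
  obtain n where n: "depends_on (window n) f" using f cylinder_window by blast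
  obtain C where C: "0 \<le> C" "\<And>\<eta>. \<bar>f \<eta>\<bar> \<le> C" using cylinder_bounded[OF f] by blast
  let ?d = "\<bar>(\<integral>\<eta>. f \<eta> \<partial>law_at P \<mu> t) - (\<integral>\<eta>. f \<eta> \<partial>\<mu>)\<bar>"
  have "?d \<le> (2 * C * fact n * 2 ^ n) * (1 / 2) ^ k" for k
  proof -
    have "?d \<le> 2 * (8 ^ k * fact (n + k) * C) * t ^ k / fact k"
      by (rule law_at_taylor[OF P \<mu> gen f t(1)]) (use generator_iterate_bound[OF n C(2), of k] C in auto)
    also have "\<dots> = 2 * C * ((8 * t) ^ k * (fact (n + k) / fact k))"
      by (simp add: power_mult_distrib)
    also have "fact (n + k) / fact k = fact n * real ((n + k) choose n)"
      by (simp add: binomial_fact field_simps)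
    also have "2 * C * ((8 * t) ^ k * (fact n * real ((n + k) choose n)))
        \<le> 2 * C * ((1 / 4) ^ k * (fact n * 2 ^ (n + k)))"
    proof -
      have "real ((n + k) choose n) \<le> 2 ^ (n + k)"
        using binomial_le_pow2[of "n + k" n] by (metis of_nat_le_iff of_nat_numeral of_nat_power)
      then show ?thesis using t C by (intro mult_left_mono mult_mono power_mono) auto
    qed
    also have "\<dots> = (2 * C * fact n * 2 ^ n) * ((1 / 4) ^ k * 2 ^ k)"
      by (simp add: power_add)
    also have "(1 / 4) ^ k * 2 ^ k = (1 / 2 :: real) ^ k"
      by (simp flip: power_mult_distrib)
    finally show ?thesis .
  qed
  moreover have "(\<lambda>k. (2 * C * fact n * 2 ^ n) * (1 / 2) ^ k) \<longlonglongrightarrow> (2 * C * fact n * 2 ^ n) * (0 :: real)"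
    by (intro tendsto_intros LIMSEQ_power_zero) simp
  ultimately have "?d \<le> (2 * C * fact n * 2 ^ n) * 0" by (intro LIMSEQ_le_const) auto
  then show "(\<integral>\<eta>. f \<eta> \<partial>law_at P \<mu> t) = (\<integral>\<eta>. f \<eta> \<partial>\<mu>)" by simp
qed

text \<open>The length of the time interval in \<open>invariant_short_time\<close> does not depend on the test function,
  so the semigroup property carries invariance to all times. This takes the place of the argument
  that the cylinder functions form a core.\<close>

theorem invariant_if_generator_zero:
  assumes P: "ftasep P" and \<mu>: "prob_on \<mu>"
    and gen: "\<And>f. cylinder f \<Longrightarrow> (\<integral>\<eta>. ftasep_generator f \<eta> \<partial>\<mu>) = 0"
  shows "invariant_for P \<mu>"
  unfolding invariant_for_def
proof (intro allI impI)
  fix t :: real assume t: "0 \<le> t"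
  obtain N where N: "32 * t < real N" using reals_Archimedean2 by blast
  define h where "h = t / real N"
  have h: "0 \<le> h" "h \<le> 1 / 32" using t N by (auto simp: h_def field_simps)
  have "law_at P \<mu> (real j * h) = \<mu>" for j
  proof (induction j)
    case (Suc j)
    have "law_at P \<mu> (real (Suc j) * h) = law_at P (law_at P \<mu> (real j * h)) h"
      using law_at_add[OF P _ _ \<mu>, of "real j * h" h] h by (simp add: algebra_simps)
    then show ?case using Suc invariant_short_time[OF P \<mu> gen h] by simp
  qed (simp add: law_at_0[OF P \<mu>])
  from this[of N] show "law_at P \<mu> t = \<mu>" using N t by (auto simp: h_def)
qed

lemma generator_zero_if_invariant:
  assumes P: "ftasep P" and \<mu>: "prob_on \<mu>" and inv: "invariant_for P \<mu>" and f: "cylinder f"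
  shows "(\<integral>\<eta>. ftasep_generator f \<eta> \<partial>\<mu>) = 0"
proof -
  let ?I = "\<integral>\<eta>. ftasep_generator f \<eta> \<partial>\<mu>"
  have "\<bar>?I\<bar> \<le> 0 + \<epsilon>" if "0 < \<epsilon>" for \<epsilon>
  proof -
    obtain \<delta> where \<delta>: "0 < \<delta>" "\<And>h. 0 < h \<Longrightarrow> h < \<delta> \<Longrightarrow>
        \<bar>(\<integral>\<eta>. f \<eta> \<partial>law_at P \<mu> h) - (\<integral>\<eta>. f \<eta> \<partial>\<mu>) - h * ?I\<bar> \<le> \<epsilon> * h"
      using law_at_increment[OF P f \<open>0 < \<epsilon>\<close>] \<mu> by blast
    have "law_at P \<mu> (\<delta> / 2) = \<mu>" using inv \<delta>(1) by (simp add: invariant_for_def)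
    with \<delta>(2)[of "\<delta> / 2"] \<delta>(1) have "\<bar>?I\<bar> * (\<delta> / 2) \<le> \<epsilon> * (\<delta> / 2)"
      by (simp add: abs_mult)
    then show ?thesis using \<delta>(1) by (simp add: mult_le_cancel_right)
  qed
  then have "\<bar>?I\<bar> \<le> 0" by (rule field_le_epsilon)
  then show ?thesis by simp
qed

section \<open>Density above one half is necessary\<close>

lemma measure_shift:
  assumes \<mu>: "prob_on \<mu>" "translation_invariant \<mu>" and Q[measurable]: "Measurable.pred borel Q"
  shows "measure \<mu> {\<eta>. Q (shift_config a \<eta>)} = measure \<mu> {\<eta>. Q \<eta>}"
proof -
  have [measurable_cong]: "sets \<mu> = sets borel" using \<mu> by (simp add: prob_onD)
  have "measure \<mu> {\<eta>. Q \<eta>} = measure (distr \<mu> borel (shift_config a)) {\<eta>. Q \<eta>}"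
    using \<mu> by (simp add: translation_invariant_def)
  also have "\<dots> = measure \<mu> (shift_config a -` {\<eta>. Q \<eta>} \<inter> space \<mu>)"
    by (rule measure_distr) (use Q in \<open>auto simp: pred_def\<close>)
  finally show ?thesis using \<mu> by (simp add: prob_onD vimage_def)
qed

text \<open>The zero-one law for shift-invariant events.\<close>

lemma AE_of_ergodic:
  assumes \<mu>: "prob_on \<mu>" and erg: "spatially_ergodic \<mu>" and Q[measurable]: "Measurable.pred borel Q"
    and inv: "\<And>a \<eta>. Q (shift_config a \<eta>) = Q \<eta>" and pos: "measure \<mu> {\<eta>. Q \<eta>} \<noteq> 0"
  shows "AE \<eta> in \<mu>. Q \<eta>"
proof -
  have [measurable_cong]: "sets \<mu> = sets borel" using \<mu> by (simp add: prob_onD)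
  interpret prob_space \<mu> using \<mu> by (rule prob_onD)
  have "(\<lambda>\<eta>. of_bool (Q \<eta>) :: real) \<in> borel_measurable borel" by measurable
  moreover have "\<forall>a. (\<lambda>\<eta>. of_bool (Q \<eta>) :: real) \<circ> shift_config a = (\<lambda>\<eta>. of_bool (Q \<eta>))"
    by (simp add: fun_eq_iff inv)
  ultimately obtain c :: real where c: "AE \<eta> in \<mu>. of_bool (Q \<eta>) = c"
    using erg unfolding spatially_ergodic_def by blast
  show ?thesis
  proof (cases "c = 1")
    case True
    then show ?thesis using c by (auto elim!: eventually_mono)
  next
    case False
    have "AE \<eta> in \<mu>. \<not> Q \<eta>" using c by eventually_elim (use False in auto)
    then have "measure \<mu> {\<eta>\<in>space \<mu>. Q \<eta>} = 0" by (subst prob_eq_0) auto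
    then show ?thesis using pos \<mu> by (simp add: prob_onD)
  qed
qed

text \<open>The word \<open>1(10)\<^sup>k0\<close> starting at \<open>x\<close>. For \<open>k > 0\<close> it is the shortest connection from a pair of
  adjacent particles to a pair of adjacent holes on its right: in between, the sites alternate.\<close>

definition word_at :: "nat \<Rightarrow> int \<Rightarrow> config \<Rightarrow> bool" where
  "word_at k x \<eta> \<longleftrightarrow> \<eta> x \<and> (\<forall>j<k. \<eta> (x + 1 + 2 * int j) \<and> \<not> \<eta> (x + 2 + 2 * int j)) \<and> \<not> \<eta> (x + 2 * int k + 1)"

text \<open>Take a pair of particles and a pair of holes to its right at minimal distance. No two adjacent
  sites strictly between them agree, so the configuration alternates there and spells such a word.\<close>

lemma word_between:
  assumes "\<eta> y" "\<eta> (y + 1)" "\<not> \<eta> (y + int n)" "\<not> \<eta> (y + int n + 1)"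
  shows "\<exists>x k. 0 < k \<and> word_at k x \<eta>"
  using assms
proof (induction n arbitrary: y rule: less_induct)
  case (less n)
  show ?case
  proof (cases "\<exists>i. 0 < i \<and> i < n \<and> \<eta> (y + int i) = \<eta> (y + int i + 1)")
    case True
    then obtain i where i: "0 < i" "i < n" "\<eta> (y + int i) = \<eta> (y + int i + 1)" by blast
    show ?thesis
    proof (cases "\<eta> (y + int i)")
      case True
      then show ?thesis
        using less.IH[of "n - i" "y + int i"] i less.prems by (simp add: of_nat_diff)
    next
      case False
      then show ?thesis using less.IH[OF i(2), of y] i less.prems by simp
    qed
  next
    case False
    \<comment> \<open>The alternation starts with the particle at \<open>y + 1\<close>.\<close>
    have alt: "\<eta> (y + int i) = odd i" if "0 < i" "i \<le> n" for i
      using that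
    proof (induction i)
      case (Suc i)
      show ?case
      proof (cases "i = 0")
        case True then show ?thesis using less.prems by simp
      next
        case False': False
        then have "\<eta> (y + int i) \<noteq> \<eta> (y + int i + 1)"
          using False[simplified, rule_format, of i] Suc.prems by simp
        then show ?thesis using Suc False' by (simp add: algebra_simps)
      qed
    qed simp
    have "n \<noteq> 0" using less.prems by (cases n) auto
    then have "even n" using alt[of n] less.prems by auto
    then obtain k where k: "n = 2 * k" by blast
    have "word_at k y \<eta>"
      unfolding word_at_def
    proof (intro conjI allI impI)
      fix j assume "j < k"
      have "y + int (2 * j + 1) = y + 1 + 2 * int j" "y + int (2 * j + 2) = y + 2 + 2 * int j" by auto
      then show "\<eta> (y + 1 + 2 * int j)" "\<not> \<eta> (y + 2 + 2 * int j)"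
        using alt[of "2 * j + 1"] alt[of "2 * j + 2"] \<open>j < k\<close> k by (auto simp: add.assoc)
    qed (use less.prems k in auto)
    then show ?thesis using k \<open>n \<noteq> 0\<close> by auto
  qed
qed

lemma measurable_word [measurable]: "Measurable.pred borel (word_at k x)"
  unfolding word_at_def by measurable

lemma depends_on_word: "depends_on {x..x + 2 * int k + 1} (\<lambda>\<eta>. of_bool (word_at k x \<eta>) :: real)"
  unfolding depends_on_def word_at_def by (auto simp: of_bool_def)

text \<open>Induction on \<open>k\<close>, using stationarity of the probability of one event at each stage.
  Jumps never create a pair of adjacent holes, and the jump \<open>1100 \<rightarrow> 1010\<close> destroys one; since the
  probability of a pair of holes is stationary, \<open>1100\<close> has probability \<open>0\<close>. If \<open>1(10)\<^sup>k0\<close> has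
  probability \<open>0\<close>, so has its loss rate and hence its gain rate; but the jump
  \<open>110(10)\<^sup>k0 \<rightarrow> 101(10)\<^sup>k0\<close> creates this word two sites further right, so
  \<open>1(10)\<^bsup>k+1\<^esup>0\<close> has probability \<open>0\<close> as well.\<close>

lemma AE_no_word:
  assumes P: "ftasep P" and \<mu>: "prob_on \<mu>" and inv: "invariant_for P \<mu>"
  shows "AE \<eta> in \<mu>. \<not> word_at (Suc k) x \<eta>"
proof (induction k arbitrary: x)
  have [measurable_cong]: "sets \<mu> = sets borel" using \<mu> by (simp add: prob_onD)
  interpret prob_space \<mu> using \<mu> by (rule prob_onD)
  have zero: "AE \<eta> in \<mu>. \<not> Q \<eta>"
    if [measurable]: "Measurable.pred borel Q" and "(\<integral>\<eta>. of_bool (Q \<eta>) \<partial>\<mu>) = (0::real)" for Q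
  proof -
    have "(\<integral>\<eta>. of_bool (Q \<eta>) \<partial>\<mu>) = measure \<mu> {\<eta>. Q \<eta>}"
    proof -
      have "(\<lambda>\<eta>. of_bool (Q \<eta>) :: real) = indicator {\<eta>. Q \<eta>}" by (auto simp: indicator_def)
      then show ?thesis using \<mu> by (simp add: prob_onD)
    qed
    then have "measure \<mu> {\<eta>\<in>space \<mu>. Q \<eta>} = 0" using that \<mu> by (simp add: prob_onD)
    then show ?thesis by (subst (asm) prob_eq_0) auto
  qed
  {
    case 0
    define f :: "config \<Rightarrow> real" where "f \<eta> = of_bool (\<not> \<eta> (x + 2) \<and> \<not> \<eta> (x + 3))" for \<eta>
    have dep: "depends_on {x + 2..x + 3} f" by (auto simp: depends_on_def f_def)
    then have cyl: "cylinder f" using cylinder_iff by blast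
    have "ftasep_generator f \<eta> = - of_bool (word_at 1 x \<eta>)" for \<eta>
    proof -
      have "{x + 1, x + 2, x + 3} = {x + 2 - 1..x + 3}" by auto
      then have "ftasep_generator f \<eta> = (\<Sum>y\<in>{x + 1, x + 2, x + 3}. of_bool (jump_allowed y \<eta>) * (f (exchange y \<eta>) - f \<eta>))"
        by (intro generator_eq_sum[OF dep]) auto
      also have "\<dots> = - of_bool (word_at 1 x \<eta>)"
        by (auto simp: f_def jump_allowed_def exchange_def word_at_def add.commute[of _ x])
      finally show ?thesis .
    qed
    then have "(\<integral>\<eta>. of_bool (word_at 1 x \<eta>) \<partial>\<mu>) = (0::real)"
      using generator_zero_if_invariant[OF P \<mu> inv cyl] by simp
    then show ?case using zero[of "word_at 1 x"] by simp
  next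
    case (Suc k)
    define f :: "config \<Rightarrow> real" where "f \<eta> = of_bool (word_at (Suc k) (x + 2) \<eta>)" for \<eta>
    have dep: "depends_on {x + 2..x + 2 + 2 * int (Suc k) + 1} f"
      unfolding f_def by (rule depends_on_word)
    then have cyl: "cylinder f" using cylinder_iff by blast
    obtain C where C: "\<And>\<eta>. \<bar>ftasep_generator f \<eta>\<bar> \<le> C"
      using cylinder_bounded[OF cylinder_generator[OF cyl]] by blast
    let ?w = "\<lambda>\<eta>. of_bool (word_at (Suc (Suc k)) x \<eta>) :: real"
    have gain: "?w \<eta> \<le> ftasep_generator f \<eta>" if "\<not> word_at (Suc k) (x + 2) \<eta>" for \<eta>
    proof -
      let ?A = "{x + 1..x + 2 + 2 * int (Suc k) + 1}"
      have eq: "ftasep_generator f \<eta> = (\<Sum>y\<in>?A. of_bool (jump_allowed y \<eta>) * (f (exchange y \<eta>) - f \<eta>))"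
        by (rule generator_eq_sum[OF dep]) auto
      have nonneg: "0 \<le> of_bool (jump_allowed y \<eta>) * (f (exchange y \<eta>) - f \<eta>)" for y
        using that by (simp add: f_def)
      have "?w \<eta> \<le> of_bool (jump_allowed (x + 1) \<eta>) * (f (exchange (x + 1) \<eta>) - f \<eta>)"
      proof (cases "word_at (Suc (Suc k)) x \<eta>")
        case True
        then have j: "\<eta> (x + 1 + 2 * int j)" "\<not> \<eta> (x + 2 + 2 * int j)" if "j < Suc (Suc k)" for j
          using that by (auto simp: word_at_def)
        have "jump_allowed (x + 1) \<eta>"
          using True j[of 0] by (auto simp: jump_allowed_def word_at_def add.commute)
        moreover have "word_at (Suc k) (x + 2) (exchange (x + 1) \<eta>)"
          unfolding word_at_def
        proof (intro conjI allI impI)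
          show "exchange (x + 1) \<eta> (x + 2)" using j(1)[of 0] by (simp add: exchange_def)
          show "\<not> exchange (x + 1) \<eta> (x + 2 + 2 * int (Suc k) + 1)"
            using True by (auto simp: exchange_def word_at_def algebra_simps)
          fix i assume "i < Suc k"
          then show "exchange (x + 1) \<eta> (x + 2 + 1 + 2 * int i)" "\<not> exchange (x + 1) \<eta> (x + 2 + 2 + 2 * int i)"
            using j[of "Suc i"] by (auto simp: exchange_def algebra_simps)
        qed
        ultimately show ?thesis using that True by (simp add: f_def)
      next
        case False
        then show ?thesis using nonneg by simp
      qed
      also have "\<dots> \<le> ftasep_generator f \<eta>"
        unfolding eq by (rule member_le_sum) (use nonneg in auto)
      finally show ?thesis .
    qed
    have "(\<integral>\<eta>. ?w \<eta> \<partial>\<mu>) \<le> (\<integral>\<eta>. ftasep_generator f \<eta> \<partial>\<mu>)"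
    proof (rule integral_mono_AE)
      show "integrable \<mu> ?w" by (rule prob_on_integrable[OF \<mu>, of _ 1]) auto
      show "integrable \<mu> (ftasep_generator f)"
        by (rule prob_on_integrable[OF \<mu> cylinder_measurable[OF P cylinder_generator[OF cyl]] C])
      show "AE \<eta> in \<mu>. ?w \<eta> \<le> ftasep_generator f \<eta>"
        using Suc[of "x + 2"] by eventually_elim (rule gain)
    qed
    then have "(\<integral>\<eta>. ?w \<eta> \<partial>\<mu>) \<le> 0"
      using generator_zero_if_invariant[OF P \<mu> inv cyl] by simp
    moreover have "0 \<le> (\<integral>\<eta>. ?w \<eta> \<partial>\<mu>)" by (rule integral_nonneg_AE) auto
    ultimately show ?case using zero[of "word_at (Suc (Suc k)) x"] by simp
  }
qed

text \<open>Poincare recurrence: the events that a pair of particles occurs left of \<open>z\<close> increase in \<open>z\<close> and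
  all have the same probability, so each of them is almost surely equal to their union.\<close>

lemma AE_pair_left_of:
  assumes \<mu>: "prob_on \<mu>" "translation_invariant \<mu>"
    and some: "AE \<eta> in \<mu>. \<exists>y. \<eta> y \<and> \<eta> (y + 1)"
  shows "AE \<eta> in \<mu>. \<forall>z. \<exists>y<z. \<eta> y \<and> \<eta> (y + 1)"
proof -
  have [measurable_cong]: "sets \<mu> = sets borel" using \<mu> by (simp add: prob_onD)
  interpret prob_space \<mu> by (rule prob_onD[OF \<mu>(1)])
  define C where "C z = {\<eta>::config. \<exists>y<z. \<eta> y \<and> \<eta> (y + 1)}" for z
  have meas: "C z \<in> sets \<mu>" for z
  proof -
    have "C z = {\<eta>\<in>space \<mu>. \<exists>y<z. \<eta> y \<and> \<eta> (y + 1)}" using \<mu> by (simp add: C_def prob_onD)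
    also have "\<dots> \<in> sets \<mu>" by measurable
    finally show ?thesis .
  qed
  have const: "measure \<mu> (C z) = measure \<mu> (C 0)" for z
  proof -
    have "C z = {\<eta>. shift_config z \<eta> \<in> C 0}"
    proof (intro set_eqI)
      fix \<eta>
      have "(\<exists>y<z. \<eta> y \<and> \<eta> (y + 1)) \<longleftrightarrow> (\<exists>y<0. \<eta> (z + y) \<and> \<eta> (z + y + 1))" (is "?l = ?r")
      proof
        assume ?l
        then obtain y where "y < z" "\<eta> y" "\<eta> (y + 1)" by blast
        then show ?r by (intro exI[of _ "y - z"]) simp
      next
        assume ?r
        then obtain y where "y < 0" "\<eta> (z + y)" "\<eta> (z + y + 1)" by blast
        then show ?l by (intro exI[of _ "z + y"]) simp
      qed
      then show "\<eta> \<in> C z \<longleftrightarrow> \<eta> \<in> {\<eta>. shift_config z \<eta> \<in> C 0}"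
        by (simp add: C_def shift_config_def add.assoc)
    qed
    moreover have "Measurable.pred borel (\<lambda>\<eta>. \<eta> \<in> C 0)" unfolding C_def mem_Collect_eq by measurable
    ultimately show ?thesis using measure_shift[OF \<mu>, of "\<lambda>\<eta>. \<eta> \<in> C 0" z] by simp
  qed
  have "(\<lambda>n. measure \<mu> (C (int n))) \<longlonglongrightarrow> measure \<mu> (\<Union>n. C (int n))"
  proof (rule finite_Lim_measure_incseq)
    show "range (\<lambda>n. C (int n)) \<subseteq> sets \<mu>" using meas by blast
    show "incseq (\<lambda>n. C (int n))"
    proof (intro monoI)
      fix m n :: nat assume "m \<le> n"
      then have "int m \<le> int n" by simp
      then show "C (int m) \<subseteq> C (int n)" unfolding C_def using less_le_trans by blast
    qed
  qed
  moreover have "measure \<mu> (\<Union>n. C (int n)) = 1"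
  proof (subst prob_eq_1)
    have "\<eta> \<in> (\<Union>n. C (int n))" if "\<exists>y. \<eta> y \<and> \<eta> (y + 1)" for \<eta>
    proof -
      obtain y where y: "\<eta> y" "\<eta> (y + 1)" using \<open>\<exists>y. _\<close> by blast
      have "y < int (nat (y + 1))" by linarith
      then show ?thesis using y unfolding C_def by blast
    qed
    then show "AE \<eta> in \<mu>. \<eta> \<in> (\<Union>n. C (int n))" using some by (auto elim!: eventually_mono)
  qed (use meas in auto)
  ultimately have "measure \<mu> (C 0) = 1"
  proof -
    assume "(\<lambda>n. measure \<mu> (C (int n))) \<longlonglongrightarrow> measure \<mu> (\<Union>n. C (int n))"
      and "measure \<mu> (\<Union>n. C (int n)) = 1"
    moreover have "(\<lambda>n. measure \<mu> (C (int n))) = (\<lambda>_. measure \<mu> (C 0))"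
      by (intro ext const)
    ultimately show "measure \<mu> (C 0) = 1" by (simp only: LIMSEQ_const_iff)
  qed
  then have "AE \<eta> in \<mu>. \<eta> \<in> C z" for z using const meas prob_eq_1 by metis
  then have "AE \<eta> in \<mu>. \<forall>z. \<eta> \<in> C z" by (simp add: AE_all_countable)
  then show ?thesis by (simp add: C_def)
qed

text \<open>If \<open>\<rho> \<le> 1 / 2\<close>, then \<open>P(00) = 1 - 2\<rho> + P(11) \<ge> P(11) > 0\<close>. By ergodicity almost every
  configuration has a pair of holes, and a pair of particles to the left of it, in contradiction to
  \<open>word_between\<close> and \<open>AE_no_word\<close>.\<close>

theorem no_invariant_low_density:
  assumes P: "ftasep P" and \<mu>: "prob_on \<mu>" and erg: "spatially_ergodic \<mu>"
    and nondeg: "\<not> degenerate \<mu>" and dens: "has_density \<mu> \<rho>" and inv: "invariant_for P \<mu>"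
  shows "1 / 2 < \<rho>"
proof (rule ccontr)
  assume "\<not> 1 / 2 < \<rho>"
  have [measurable_cong]: "sets \<mu> = sets borel" using \<mu> by (simp add: prob_onD)
  interpret prob_space \<mu> using \<mu> by (rule prob_onD)
  have sp: "space \<mu> = UNIV" using \<mu> by (rule prob_onD)
  have meas: "{\<eta>. Q \<eta>} \<in> sets \<mu>" if "Measurable.pred borel Q" for Q
    using that \<open>sets \<mu> = sets borel\<close> by (simp add: pred_def)
  have ti: "translation_invariant \<mu>" using erg by (simp add: spatially_ergodic_def)
  obtain x where x: "measure \<mu> {\<eta>. \<eta> x \<and> \<eta> (x + 1)} \<noteq> 0" using nondeg by (auto simp: degenerate_def)
  let ?A = "{\<eta>::config. \<eta> x}" and ?B = "{\<eta>::config. \<eta> (x + 1)}"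
  have AB: "?A \<in> sets \<mu>" "?B \<in> sets \<mu>" by (auto intro!: meas)
  have holes: "measure \<mu> {\<eta>. \<not> \<eta> x \<and> \<not> \<eta> (x + 1)} \<noteq> 0"
  proof -
    have "{\<eta>. \<not> \<eta> x \<and> \<not> \<eta> (x + 1)} = space \<mu> - (?A \<union> ?B)" using sp by auto
    then have "measure \<mu> {\<eta>. \<not> \<eta> x \<and> \<not> \<eta> (x + 1)} = 1 - measure \<mu> (?A \<union> ?B)"
      using AB by (simp add: prob_compl)
    also have "measure \<mu> (?A \<union> ?B) = measure \<mu> ?A + measure \<mu> ?B - measure \<mu> (?A \<inter> ?B)"
      using AB by (intro measure_Un3) (auto simp: fmeasurable_eq_sets)
    also have "?A \<inter> ?B = {\<eta>. \<eta> x \<and> \<eta> (x + 1)}" by auto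
    finally have "measure \<mu> {\<eta>. \<not> \<eta> x \<and> \<not> \<eta> (x + 1)}
        = 1 - 2 * \<rho> + measure \<mu> {\<eta>. \<eta> x \<and> \<eta> (x + 1)}"
      using dens by (simp add: has_density_def)
    then show ?thesis
      using x \<open>\<not> 1 / 2 < \<rho>\<close> measure_nonneg[of \<mu> "{\<eta>. \<eta> x \<and> \<eta> (x + 1)}"] by linarith
  qed
  have some: "AE \<eta> in \<mu>. \<exists>y. Q (shift_config y \<eta>)"
    if [measurable]: "Measurable.pred borel Q" and pos: "measure \<mu> {\<eta>. Q (shift_config x \<eta>)} \<noteq> 0" for Q
  proof (rule AE_of_ergodic[OF \<mu> erg])
    show "Measurable.pred borel (\<lambda>\<eta>. \<exists>y. Q (shift_config y \<eta>))" by measurable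
    show "(\<exists>y. Q (shift_config y (shift_config a \<eta>))) = (\<exists>y. Q (shift_config y \<eta>))" for a \<eta>
    proof -
      have "shift_config y (shift_config a \<eta>) = shift_config (a + y) \<eta>" for y
        by (simp add: shift_config_def add.assoc)
      then show ?thesis by (metis add_diff_cancel_left' diff_add_cancel add.commute)
    qed
    have "measure \<mu> {\<eta>. Q (shift_config x \<eta>)} \<le> measure \<mu> {\<eta>. \<exists>y. Q (shift_config y \<eta>)}"
      by (intro finite_measure_mono meas) auto
    then show "measure \<mu> {\<eta>. \<exists>y. Q (shift_config y \<eta>)} \<noteq> 0"
      using pos measure_nonneg[of \<mu> "{\<eta>. Q (shift_config x \<eta>)}"] by linarith
  qed
  have "AE \<eta> in \<mu>. \<exists>y. \<eta> y \<and> \<eta> (y + 1)"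
    using some[of "\<lambda>\<eta>. \<eta> 0 \<and> \<eta> 1"] x by (simp add: shift_config_def)
  then have left: "AE \<eta> in \<mu>. \<forall>z. \<exists>y<z. \<eta> y \<and> \<eta> (y + 1)" by (rule AE_pair_left_of[OF \<mu> ti])
  have right: "AE \<eta> in \<mu>. \<exists>z. \<not> \<eta> z \<and> \<not> \<eta> (z + 1)"
    using some[of "\<lambda>\<eta>. \<not> \<eta> 0 \<and> \<not> \<eta> 1"] holes by (simp add: shift_config_def)
  have none: "AE \<eta> in \<mu>. \<forall>k x. \<not> word_at (Suc k) x \<eta>"
    using AE_no_word[OF P \<mu> inv] by (simp add: AE_all_countable)
  have "AE \<eta> in \<mu>. False"
    using left right none
  proof eventually_elim
    case (elim \<eta>)
    then obtain z where z: "\<not> \<eta> z" "\<not> \<eta> (z + 1)" by blast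
    with elim obtain y where y: "y < z" "\<eta> y" "\<eta> (y + 1)" by blast
    have "\<exists>x k. 0 < k \<and> word_at k x \<eta>"
      by (rule word_between[of _ y "nat (z - y)"]) (use y z in auto)
    then show False using elim by (metis Suc_pred)
  qed
  then show False by simp
qed

section \<open>Mixing measures\<close>

definition mixing :: "config measure \<Rightarrow> bool" where
  "mixing \<mu> \<longleftrightarrow> (\<forall>A\<in>sets borel. \<forall>C\<in>sets borel.
     (\<lambda>n. measure \<mu> (A \<inter> shift_config (int n) -` C)) \<longlonglongrightarrow> measure \<mu> A * measure \<mu> C)"

text \<open>The finite-dimensional rectangles. They generate the Borel sets and, unlike the cylinder sets,
  have product probabilities under a product measure.\<close>

definition box :: "int set \<Rightarrow> (int \<Rightarrow> bool set) \<Rightarrow> config set" where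
  "box J X = {\<eta>. \<forall>i\<in>J. \<eta> i \<in> X i}"

lemma sets_borel_box: "sets (borel :: config measure) = sigma_sets UNIV {box J X |J X. finite J}"
  (is "_ = sigma_sets UNIV ?G")
proof
  have "prod_algebra UNIV (\<lambda>_::int. borel :: bool measure) \<subseteq> ?G"
  proof
    fix A assume "A \<in> prod_algebra UNIV (\<lambda>_::int. borel :: bool measure)"
    then obtain J E where A: "A = prod_emb UNIV (\<lambda>_. borel) J (\<Pi>\<^sub>E j\<in>J. E j)" "finite J"
      by (rule prod_algebraE)
    have "A = box J E" unfolding A by (auto simp: prod_emb_def box_def PiE_iff)
    then show "A \<in> ?G" using A by blast
  qed
  then show "sets (borel :: config measure) \<subseteq> sigma_sets UNIV ?G"
    unfolding sets_config sets_PiM by (simp add: sigma_sets_mono')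
  have "box J X \<in> sets borel" if "finite J" for J X
  proof -
    have "{\<eta>\<in>space (borel :: config measure). \<forall>i\<in>J. \<eta> i \<in> X i} \<in> sets borel"
      using that by (intro sets.sets_Collect_finite_All) measurable
    then show ?thesis by (simp add: box_def)
  qed
  then show "sigma_sets UNIV ?G \<subseteq> sets borel"
    using sets.sigma_sets_subset[of ?G "borel :: config measure"] by auto
qed

lemma Int_stable_box: "Int_stable {box J X |J X. finite J}"
proof (rule Int_stableI, clarify)
  fix J K :: "int set" and X Y assume fin: "finite J" "finite K"
  have "box J X \<inter> box K Y = box (J \<union> K) (\<lambda>i. (if i \<in> J then X i else UNIV) \<inter> (if i \<in> K then Y i else UNIV))"
    by (auto simp: box_def split: if_splits)
  then show "\<exists>L Z. box J X \<inter> box K Y = box L Z \<and> finite L" using fin by blast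
qed

text \<open>A convergence criterion in the style of Dynkin's lemma. The functions \<open>\<kappa> n\<close> are measures
  dominated by \<open>\<mu>\<close>; the domination is what allows the limit to be exchanged with countable disjoint
  unions.\<close>

lemma tendsto_on_borel_if_on_boxes:
  fixes \<kappa> :: "nat \<Rightarrow> config set \<Rightarrow> real"
  assumes \<mu>: "prob_on \<mu>"
    and le: "\<And>n A. A \<in> sets borel \<Longrightarrow> 0 \<le> \<kappa> n A \<and> \<kappa> n A \<le> measure \<mu> A"
    and compl: "\<And>n A. A \<in> sets borel \<Longrightarrow> \<kappa> n (UNIV - A) = \<kappa> n UNIV - \<kappa> n A"
    and union: "\<And>n A. disjoint_family A \<Longrightarrow> range A \<subseteq> sets borel \<Longrightarrow> (\<lambda>i. \<kappa> n (A i)) sums \<kappa> n (\<Union>i::nat. A i)"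
    and box: "\<And>J X. finite J \<Longrightarrow> (\<lambda>n. \<kappa> n (box J X)) \<longlonglongrightarrow> c * measure \<mu> (box J X)"
    and A: "A \<in> sets borel"
  shows "(\<lambda>n. \<kappa> n A) \<longlonglongrightarrow> c * measure \<mu> A"
proof -
  interpret prob_space \<mu> using \<mu> by (rule prob_onD)
  note sets_\<mu> = prob_onD(2,3)[OF \<mu>]
  have UNIV: "(\<lambda>n. \<kappa> n UNIV) \<longlonglongrightarrow> c"
    using box[of "{}" undefined] prob_space sets_\<mu> by (simp add: box_def)
  have "{box J X |J X. finite J} \<subseteq> Pow UNIV" by simp
  from Int_stable_box this A[unfolded sets_borel_box] show ?thesis
  proof (induction rule: sigma_sets_induct_disjoint)
    case (basic A)
    then show ?case using box by auto
  next
    case empty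
    have "\<kappa> n {} = 0" for n using le[of "{}" n] by simp
    then show ?case by simp
  next
    case (compl A)
    then have A: "A \<in> sets borel" by (simp add: sets_borel_box)
    have "measure \<mu> (UNIV - A) = 1 - measure \<mu> A"
      using prob_compl[of A] A sets_\<mu> by simp
    then have "c * measure \<mu> (UNIV - A) = c - c * measure \<mu> A"
      by (simp add: right_diff_distrib)
    then show ?case using tendsto_diff[OF UNIV compl(2)] assms(3)[OF A] by simp
  next
    case (union A)
    then have A: "range A \<subseteq> sets borel" by (simp add: sets_borel_box)
    have sum: "(\<lambda>i. measure \<mu> (A i)) sums measure \<mu> (\<Union>i. A i)"
      using union(1) A sets_\<mu> by (intro finite_measure_UNION) auto
    have "(\<lambda>n. \<Sum>i. \<kappa> n (A i)) \<longlonglongrightarrow> (\<Sum>i. c * measure \<mu> (A i))"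
    proof (rule tannerys_theorem[THEN conjunct2, THEN conjunct2])
      show "summable (\<lambda>i. measure \<mu> (A i))" using sum by (rule sums_summable)
      show "\<forall>\<^sub>F (i, n) in at_top \<times>\<^sub>F sequentially. norm (\<kappa> n (A i)) \<le> measure \<mu> (A i)"
        using le A by (intro always_eventually) (auto simp: range_subsetD)
    qed (use union(3) in auto)
    moreover have "(\<Sum>i. \<kappa> n (A i)) = \<kappa> n (\<Union>i. A i)" for n
      using assms(4)[OF union(1) A] by (simp add: sums_iff)
    moreover have "(\<Sum>i. c * measure \<mu> (A i)) = c * measure \<mu> (\<Union>i. A i)"
      using sums_mult[OF sum, of c] by (simp add: sums_iff)
    ultimately show ?case by simp
  qed
qed

lemma vimage_shift_sets: "C \<in> sets borel \<Longrightarrow> shift_config a -` C \<in> sets borel"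
  using measurable_sets[OF measurable_shift, of C a] by simp

lemma measure_shift_vimage:
  assumes "prob_on \<mu>" "translation_invariant \<mu>" "C \<in> sets borel"
  shows "measure \<mu> (shift_config a -` C) = measure \<mu> C"
  using measure_shift[OF assms(1,2), of "\<lambda>\<eta>. \<eta> \<in> C" a] assms(3)
  by (simp add: pred_def vimage_def)

lemma shift_vimage_box: "shift_config a -` box J X = box ((+) a ` J) (\<lambda>i. X (i - a))"
  by (auto simp: box_def shift_config_def)

text \<open>Independence of disjoint boxes gives the mixing limit for two boxes, with equality once the shift
  separates them. The limit is then extended to Borel sets in one argument at a time, through the
  measures \<open>A \<mapsto> \<mu>(A \<inter> T\<^sub>n C)\<close> and \<open>C \<mapsto> \<mu>(A \<inter> T\<^sub>n C)\<close>; the second is dominated by \<open>\<mu>\<close> thanks to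
  translation invariance.\<close>

lemma mixingI_box:
  assumes \<mu>: "prob_on \<mu>" "translation_invariant \<mu>"
    and indep: "\<And>J K X Y. finite J \<Longrightarrow> finite K \<Longrightarrow> J \<inter> K = {} \<Longrightarrow>
      measure \<mu> (box J X \<inter> box K Y) = measure \<mu> (box J X) * measure \<mu> (box K Y)"
  shows "mixing \<mu>"
proof -
  interpret prob_space \<mu> using \<mu>(1) by (rule prob_onD)
  note sets_\<mu> = prob_onD(2,3)[OF \<mu>(1)]
  have box_sets: "box J X \<in> sets borel" if "finite J" for J X
    using that unfolding sets_borel_box by blast
  have box_box: "(\<lambda>n. measure \<mu> (box J X \<inter> shift_config (int n) -` box K Y)) \<longlonglongrightarrow> measure \<mu> (box J X) * measure \<mu> (box K Y)"
    if fin: "finite J" "finite K" for J K X Y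
  proof (rule tendsto_eventually)
    obtain m where m: "J \<union> K \<subseteq> window m" using finite_subset_window fin by (metis finite_UnI)
    show "\<forall>\<^sub>F n in sequentially. measure \<mu> (box J X \<inter> shift_config (int n) -` box K Y)
        = measure \<mu> (box J X) * measure \<mu> (box K Y)"
      using eventually_gt_at_top[of "2 * m"]
    proof eventually_elim
      case (elim n)
      have "J \<inter> (+) (int n) ` K = {}"
      proof -
        have "x \<notin> J" if "x = int n + y" "y \<in> K" for x y
        proof
          assume "x \<in> J"
          then have "x \<in> window m" "y \<in> window m" using m that by auto
          then show False using elim that by (simp add: window_def)
        qed
        then show ?thesis by blast
      qed
      then have "measure \<mu> (box J X \<inter> shift_config (int n) -` box K Y)
          = measure \<mu> (box J X) * measure \<mu> (shift_config (int n) -` box K Y)"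
        unfolding shift_vimage_box using fin by (intro indep) auto
      also have "measure \<mu> (shift_config (int n) -` box K Y) = measure \<mu> (box K Y)"
        using fin by (intro measure_shift_vimage[OF \<mu>] box_sets)
      finally show ?case .
    qed
  qed
  have sums: "(\<lambda>i. measure \<mu> (f (A i))) sums measure \<mu> (f (\<Union>i. A i))"
    if "disjoint_family A" "range A \<subseteq> sets borel" "\<And>A. A \<in> sets borel \<Longrightarrow> f A \<in> sets borel"
      and "\<And>A :: nat \<Rightarrow> config set. f (\<Union>i. A i) = (\<Union>i. f (A i))" "\<And>A B. A \<inter> B = {} \<Longrightarrow> f A \<inter> f B = {}"
    for f :: "config set \<Rightarrow> config set" and A :: "nat \<Rightarrow> config set"
    by (subst that(4), rule finite_measure_UNION)
      (use that(1-3,5) sets_\<mu> in \<open>auto simp: disjoint_family_on_def subset_eq\<close>)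
  have compl: "measure \<mu> (f (UNIV - A)) = measure \<mu> (f UNIV) - measure \<mu> (f A)"
    if "A \<in> sets borel" "\<And>A. A \<in> sets borel \<Longrightarrow> f A \<in> sets borel"
      "f (UNIV - A) = f UNIV - f A" "f A \<subseteq> f UNIV" for f :: "config set \<Rightarrow> config set" and A
    unfolding that(3) using that sets_\<mu> by (intro finite_measure_Diff) auto
  have set_box: "(\<lambda>n. measure \<mu> (A \<inter> shift_config (int n) -` box K Y)) \<longlonglongrightarrow> measure \<mu> (box K Y) * measure \<mu> A"
    if A: "A \<in> sets borel" and K: "finite K" for A K Y
  proof (rule tendsto_on_borel_if_on_boxes[OF \<mu>(1) _ _ _ _ A])
    let ?T = "\<lambda>n. shift_config (int n) -` box K Y"
    have T: "?T n \<in> sets borel" for n using K by (intro vimage_shift_sets box_sets)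
    fix n
    show "0 \<le> measure \<mu> (A \<inter> ?T n) \<and> measure \<mu> (A \<inter> ?T n) \<le> measure \<mu> A" if "A \<in> sets borel" for A
      using that sets_\<mu> by (auto intro!: finite_measure_mono)
    show "measure \<mu> ((UNIV - A) \<inter> ?T n) = measure \<mu> (UNIV \<inter> ?T n) - measure \<mu> (A \<inter> ?T n)"
      if "A \<in> sets borel" for A
      using that T by (intro compl) auto
    show "(\<lambda>i. measure \<mu> (A i \<inter> ?T n)) sums measure \<mu> ((\<Union>i. A i) \<inter> ?T n)"
      if "disjoint_family A" "range A \<subseteq> sets borel" for A
      using that T by (intro sums[of _ "\<lambda>A. A \<inter> ?T n"]) auto
  next
    show "(\<lambda>n. measure \<mu> (box J X \<inter> shift_config (int n) -` box K Y)) \<longlonglongrightarrow> measure \<mu> (box K Y) * measure \<mu> (box J X)"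
      if "finite J" for J X
      using box_box[OF that K] by (simp add: mult.commute)
  qed
  have "(\<lambda>n. measure \<mu> (A \<inter> shift_config (int n) -` C)) \<longlonglongrightarrow> measure \<mu> A * measure \<mu> C"
    if A: "A \<in> sets borel" and C: "C \<in> sets borel" for A C
  proof (rule tendsto_on_borel_if_on_boxes[OF \<mu>(1) _ _ _ _ C])
    let ?T = "\<lambda>n. (-`) (shift_config (int n))"
    fix n
    show "0 \<le> measure \<mu> (A \<inter> ?T n C) \<and> measure \<mu> (A \<inter> ?T n C) \<le> measure \<mu> C" if "C \<in> sets borel" for C
    proof -
      have "measure \<mu> (A \<inter> ?T n C) \<le> measure \<mu> (?T n C)"
        using that sets_\<mu> vimage_shift_sets by (auto intro!: finite_measure_mono)
      then show ?thesis using measure_shift_vimage[OF \<mu> that] by simp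
    qed
    show "measure \<mu> (A \<inter> ?T n (UNIV - C)) = measure \<mu> (A \<inter> ?T n UNIV) - measure \<mu> (A \<inter> ?T n C)"
      if "C \<in> sets borel" for C
      using that A vimage_shift_sets by (intro compl[of _ "\<lambda>C. A \<inter> ?T n C"]) auto
    show "(\<lambda>i. measure \<mu> (A \<inter> ?T n (C i))) sums measure \<mu> (A \<inter> ?T n (\<Union>i. C i))"
      if "disjoint_family C" "range C \<subseteq> sets borel" for C
      using that A vimage_shift_sets by (intro sums[of _ "\<lambda>C. A \<inter> ?T n C"]) auto
  next
    show "(\<lambda>n. measure \<mu> (A \<inter> shift_config (int n) -` box J X)) \<longlonglongrightarrow> measure \<mu> A * measure \<mu> (box J X)"
      if "finite J" for J X
      using set_box[OF A that] by (simp add: mult.commute)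
  qed
  then show ?thesis by (simp add: mixing_def)
qed

text \<open>For a shift-invariant event mixing reads \<open>\<mu> A = (\<mu> A)\<^sup>2\<close>, so its probability is \<open>0\<close> or \<open>1\<close>. An
  invariant function is then constant because almost surely the rational levels above it are the
  deterministic ones.\<close>

lemma ergodic_if_mixing:
  assumes \<mu>: "prob_on \<mu>" "translation_invariant \<mu>" and mix: "mixing \<mu>"
  shows "spatially_ergodic \<mu>"
  unfolding spatially_ergodic_def
proof (intro conjI allI impI)
  interpret prob_space \<mu> using \<mu>(1) by (rule prob_onD)
  note sets_\<mu> = prob_onD(2,3)[OF \<mu>(1)]
  have [measurable_cong]: "sets \<mu> = sets borel" by (fact sets_\<mu>(1))
  fix f :: "config \<Rightarrow> real" assume f[measurable]: "f \<in> borel_measurable borel" and inv: "\<forall>x. f \<circ> shift_config x = f"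
  have zero_one: "(AE \<eta> in \<mu>. f \<eta> \<le> r) \<or> (AE \<eta> in \<mu>. \<not> f \<eta> \<le> r)" for r
  proof -
    let ?A = "{\<eta>\<in>space borel. f \<eta> \<le> r}"
    have A: "?A \<in> sets borel" by measurable
    have "?A \<inter> shift_config (int n) -` ?A = ?A" for n
      using inv by (auto simp: fun_eq_iff)
    moreover have "(\<lambda>n. measure \<mu> (?A \<inter> shift_config (int n) -` ?A)) \<longlonglongrightarrow> measure \<mu> ?A * measure \<mu> ?A"
      using mix A unfolding mixing_def by blast
    ultimately have "(\<lambda>n::nat. measure \<mu> ?A) \<longlonglongrightarrow> measure \<mu> ?A * measure \<mu> ?A"
      by (simp only:)
    then have "measure \<mu> ?A = measure \<mu> ?A * measure \<mu> ?A" by (simp add: LIMSEQ_const_iff)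
    then consider "measure \<mu> ?A = 1" | "measure \<mu> ?A = 0" by auto
    then show ?thesis
    proof cases
      case 1
      then have "AE \<eta> in \<mu>. \<eta> \<in> ?A" using A sets_\<mu> by (subst (asm) prob_eq_1) auto
      then show ?thesis by auto
    next
      case 2
      then have "AE \<eta> in \<mu>. \<eta> \<notin> ?A" using A sets_\<mu> by (subst (asm) prob_eq_0) auto
      then show ?thesis by auto
    qed
  qed
  have "AE \<eta> in \<mu>. f \<eta> \<le> r \<longleftrightarrow> (AE \<zeta> in \<mu>. f \<zeta> \<le> r)" for r
  proof (cases "AE \<zeta> in \<mu>. f \<zeta> \<le> r")
    case False
    then have "AE \<eta> in \<mu>. \<not> f \<eta> \<le> r" using zero_one by blast
    with False show ?thesis by (simp only: False simp_thms)
  qed (simp only: simp_thms)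
  then have ae: "AE \<eta> in \<mu>. \<forall>r\<in>\<rat>. f \<eta> \<le> r \<longleftrightarrow> (AE \<zeta> in \<mu>. f \<zeta> \<le> r)"
    by (subst AE_ball_countable[OF countable_rat]) blast
  then obtain \<omega> where \<omega>: "\<forall>r\<in>\<rat>. f \<omega> \<le> r \<longleftrightarrow> (AE \<zeta> in \<mu>. f \<zeta> \<le> r)"
  proof -
    have "ae_filter \<mu> \<noteq> bot" using emeasure_space_1 by (simp add: ae_filter_eq_bot_iff)
    from eventually_happens'[OF this ae] that show thesis by blast
  qed
  show "\<exists>c. AE \<eta> in \<mu>. f \<eta> = c"
  proof (rule exI, use ae in eventually_elim)
    case (elim \<eta>)
    then have *: "f \<eta> \<le> r \<longleftrightarrow> f \<omega> \<le> r" if "r \<in> \<rat>" for r using \<omega> that by auto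
    show "f \<eta> = f \<omega>"
    proof (rule ccontr)
      assume "f \<eta> \<noteq> f \<omega>"
      then have "f \<eta> < f \<omega> \<or> f \<omega> < f \<eta>" by linarith
      then obtain r where "r \<in> \<rat>" "f \<eta> < r \<and> r < f \<omega> \<or> f \<omega> < r \<and> r < f \<eta>"
        using Rats_dense_in_real by metis
      then show False using *[of r] by linarith
    qed
  qed
qed (fact \<mu>(2))

text \<open>The limits along negative shifts follow from those along positive shifts, because by translation
  invariance the two sets can exchange their roles.\<close>

lemma mixing_integral:
  assumes \<mu>: "prob_on \<mu>" "translation_invariant \<mu>" and mix: "mixing \<mu>"
    and f: "f \<in> borel_measurable borel" "finite (range f)" and C: "C \<in> sets borel"
  shows "(\<lambda>n. \<integral>\<eta>. f \<eta> * indicator C (shift_config (int n) \<eta>) \<partial>\<mu>) \<longlonglongrightarrow> (\<integral>\<eta>. f \<eta> \<partial>\<mu>) * measure \<mu> C"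
    and "(\<lambda>n. \<integral>\<eta>. f \<eta> * indicator C (shift_config (- int n) \<eta>) \<partial>\<mu>) \<longlonglongrightarrow> (\<integral>\<eta>. f \<eta> \<partial>\<mu>) * measure \<mu> C"
proof -
  interpret prob_space \<mu> using \<mu>(1) by (rule prob_onD)
  note sets_\<mu> = prob_onD(2,3)[OF \<mu>(1)]
  define F where "F v = f -` {v}" for v
  have F: "F v \<in> sets borel" for v
    using measurable_sets[OF f(1), of "{v}"] by (simp add: F_def)
  have decomp: "f \<eta> = (\<Sum>v\<in>range f. v * indicator (F v) \<eta>)" for \<eta>
  proof -
    have "(\<Sum>v\<in>range f. v * indicator (F v) \<eta>) = (\<Sum>v\<in>{f \<eta>}. v * indicator (F v) \<eta>)"
      by (rule sum.mono_neutral_right) (use f(2) in \<open>auto simp: F_def indicator_def\<close>)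
    then show ?thesis by (simp add: F_def)
  qed
  have int: "(\<integral>\<eta>. f \<eta> * indicator C (g \<eta>) \<partial>\<mu>) = (\<Sum>v\<in>range f. v * measure \<mu> (F v \<inter> g -` C))"
    if "g -` C \<in> sets borel" for g C
  proof -
    have "(\<integral>\<eta>. f \<eta> * indicator C (g \<eta>) \<partial>\<mu>) = (\<integral>\<eta>. (\<Sum>v\<in>range f. v * indicator (F v \<inter> g -` C) \<eta>) \<partial>\<mu>)"
      by (rule Bochner_Integration.integral_cong[OF refl], subst decomp)
        (simp add: sum_distrib_right indicator_def if_distrib cong: if_cong)
    also have "\<dots> = (\<Sum>v\<in>range f. \<integral>\<eta>. v * indicator (F v \<inter> g -` C) \<eta> \<partial>\<mu>)"
      using F that sets_\<mu> by (intro Bochner_Integration.integral_sum integrable_mult_right integrable_real_indicator)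
        (auto simp: less_top[symmetric])
    also have "\<dots> = (\<Sum>v\<in>range f. v * measure \<mu> (F v \<inter> g -` C))"
      using sets_\<mu> by simp
    finally show ?thesis .
  qed
  have Ef: "(\<integral>\<eta>. f \<eta> \<partial>\<mu>) = (\<Sum>v\<in>range f. v * measure \<mu> (F v))"
    using int[of id UNIV] by simp
  have lim: "(\<lambda>n. \<Sum>v\<in>range f. v * a n v) \<longlonglongrightarrow> (\<integral>\<eta>. f \<eta> \<partial>\<mu>) * measure \<mu> C"
    if "\<And>v. (\<lambda>n. a n v) \<longlonglongrightarrow> measure \<mu> (F v) * measure \<mu> C" for a :: "nat \<Rightarrow> real \<Rightarrow> real"
  proof -
    have "(\<lambda>n. \<Sum>v\<in>range f. v * a n v) \<longlonglongrightarrow> (\<Sum>v\<in>range f. v * (measure \<mu> (F v) * measure \<mu> C))"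
      by (intro tendsto_intros that)
    then show ?thesis unfolding Ef by (simp add: sum_distrib_right mult.assoc)
  qed
  show "(\<lambda>n. \<integral>\<eta>. f \<eta> * indicator C (shift_config (int n) \<eta>) \<partial>\<mu>) \<longlonglongrightarrow> (\<integral>\<eta>. f \<eta> \<partial>\<mu>) * measure \<mu> C"
    unfolding int[OF vimage_shift_sets[OF C]] using mix F C by (intro lim) (auto simp: mixing_def)
  have "measure \<mu> (F v \<inter> shift_config (- int n) -` C) = measure \<mu> (C \<inter> shift_config (int n) -` F v)" for v n
  proof -
    have "F v \<inter> shift_config (- int n) -` C \<in> sets borel" using F vimage_shift_sets[OF C] by auto
    then have "measure \<mu> (F v \<inter> shift_config (- int n) -` C)
        = measure \<mu> (shift_config (int n) -` (F v \<inter> shift_config (- int n) -` C))"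
      by (rule measure_shift_vimage[OF \<mu>, symmetric])
    also have "shift_config (int n) -` (F v \<inter> shift_config (- int n) -` C) = C \<inter> shift_config (int n) -` F v"
      by (auto simp: shift_config_def)
    finally show ?thesis .
  qed
  then show "(\<lambda>n. \<integral>\<eta>. f \<eta> * indicator C (shift_config (- int n) \<eta>) \<partial>\<mu>) \<longlonglongrightarrow> (\<integral>\<eta>. f \<eta> \<partial>\<mu>) * measure \<mu> C"
    unfolding int[OF vimage_shift_sets[OF C]] using mix F C
    by (intro lim) (auto simp: mixing_def mult.commute)
qed

section \<open>The coin-tossing measure and its filling\<close>

definition coins :: "real \<Rightarrow> config measure" where
  "coins q = Pi\<^sub>M UNIV (\<lambda>_. measure_pmf (bernoulli_pmf q))"

lemma sets_coins: "sets (coins q) = sets borel"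
  unfolding coins_def sets_config
  by (rule sets_PiM_cong) (simp_all add: sets_borel_eq_count_space)

lemma prob_on_coins: "prob_on (coins q)"
proof -
  have "prob_space (coins q)"
    unfolding coins_def by (intro prob_space_PiM) (rule prob_space_measure_pmf)
  then show ?thesis by (simp add: prob_on_def sets_coins)
qed

lemma measure_coins_box:
  assumes "finite J"
  shows "measure (coins q) (box J X) = (\<Prod>i\<in>J. measure (bernoulli_pmf q) (X i))"
proof -
  interpret product_prob_space "\<lambda>_::int. measure_pmf (bernoulli_pmf q)" UNIV
    by unfold_locales
  have "box J X = prod_emb UNIV (\<lambda>_. measure_pmf (bernoulli_pmf q)) J (Pi\<^sub>E J X)"
    by (auto simp: box_def prod_emb_def PiE_iff)
  then show ?thesis
    unfolding coins_def using assms by (simp add: measure_PiM_emb)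
qed

lemma distr_coins_reindex:
  assumes "inj \<sigma>"
  shows "distr (coins q) borel (\<lambda>B n. B (\<sigma> n)) = coins q"
proof -
  have "distr (coins q) (coins q) (\<lambda>B n. B (\<sigma> n)) = coins q"
    using distr_PiM_reindex[of UNIV "\<lambda>_. measure_pmf (bernoulli_pmf q)" \<sigma> UNIV] assms
    by (simp add: coins_def prob_space_measure_pmf restrict_UNIV)
  moreover have "distr (coins q) borel (\<lambda>B n. B (\<sigma> n)) = distr (coins q) (coins q) (\<lambda>B n. B (\<sigma> n))"
    by (rule distr_cong) (simp_all add: sets_coins)
  ultimately show ?thesis by simp
qed

lemma translation_invariant_coins: "translation_invariant (coins q)"
  unfolding translation_invariant_def
proof
  fix x
  have "shift_config x = (\<lambda>B n. B (x + n))" by (simp add: fun_eq_iff shift_config_def)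
  then show "distr (coins q) borel (shift_config x) = coins q"
    using distr_coins_reindex[of "(+) x" q] by simp
qed

lemma mixing_coins: "mixing (coins q)"
proof (rule mixingI_box[OF prob_on_coins translation_invariant_coins])
  fix J K :: "int set" and X Y
  assume fin: "finite J" "finite K" and disj: "J \<inter> K = {}"
  have "box J X \<inter> box K Y = box (J \<union> K) (\<lambda>i. if i \<in> J then X i else Y i)"
    using disj by (auto simp: box_def)
  moreover have "(\<Prod>i\<in>K. measure (bernoulli_pmf q) (if i \<in> J then X i else Y i)) = (\<Prod>i\<in>K. measure (bernoulli_pmf q) (Y i))"
    using disj by (intro prod.cong) auto
  ultimately show "measure (coins q) (box J X \<inter> box K Y) = measure (coins q) (box J X) * measure (coins q) (box K Y)"
    using fin disj by (simp add: measure_coins_box prod.union_disjoint)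
qed

definition tails_run :: "nat \<Rightarrow> int \<Rightarrow> config \<Rightarrow> bool" where
  "tails_run n x B \<longleftrightarrow> B (x - int n) \<and> (\<forall>j<n. \<not> B (x - int j))"

text \<open>The stationary Markov chain that goes from \<open>0\<close> to \<open>1\<close> with probability \<open>1\<close> and from \<open>1\<close> to \<open>1\<close> with
  the probability of a head, as a function of the coins: a site is empty iff its coin shows tails and
  its left neighbour is occupied, so along a run of tails the sites alternate. The form of the
  definition gives a meaning (all sites occupied) also to an infinite run of tails, and it commutes
  with shifts everywhere, not only almost everywhere.\<close>

definition fill :: "config \<Rightarrow> config" where
  "fill B x \<longleftrightarrow> \<not> (\<exists>n. odd n \<and> tails_run n x B)"

definition heads_recur :: "config \<Rightarrow> bool" where
  "heads_recur B \<longleftrightarrow> (\<forall>x. \<exists>n. B (x - int n))"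

lemma measurable_tails_run [measurable]: "Measurable.pred borel (tails_run n x)"
  unfolding tails_run_def by measurable

lemma measurable_fill [measurable]: "fill \<in> borel \<rightarrow>\<^sub>M borel"
  by (rule measurable_config_map) (unfold fill_def, measurable)

lemma fill_shift: "fill (shift_config a B) = shift_config a (fill B)"
proof -
  have "tails_run n x (shift_config a B) = tails_run n (a + x) B" for n x
    by (simp add: tails_run_def shift_config_def add_diff_eq)
  then show ?thesis by (simp add: fun_eq_iff fill_def shift_config_def)
qed

lemma fill_head: "B x \<Longrightarrow> fill B x"
  by (auto simp: fill_def tails_run_def) (metis odd_pos of_nat_0 diff_zero)

lemma fill_cong_left:
  assumes "\<And>y. y \<le> x \<Longrightarrow> B y = B' y" shows "fill B x = fill B' x"
  using assms by (simp add: fill_def tails_run_def)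

lemma tails_run_unique:
  assumes "tails_run m x B" "tails_run n x B" shows "m = n"
proof (rule ccontr)
  assume "m \<noteq> n"
  then have "m < n \<or> n < m" by linarith
  then show False using assms unfolding tails_run_def by blast
qed

lemma fill_iff_even_run: "tails_run n x B \<Longrightarrow> fill B x \<longleftrightarrow> even n"
  unfolding fill_def using tails_run_unique by blast

text \<open>The transition rule of the chain; it fails on an infinite run of tails.\<close>

lemma fill_rec:
  assumes "heads_recur B"
  shows "fill B x \<longleftrightarrow> B x \<or> \<not> fill B (x - 1)"
proof (cases "B x")
  case False
  have "\<exists>n. B (x - 1 - int n)" using assms by (simp add: heads_recur_def)
  then obtain n where n: "tails_run n (x - 1) B"
    unfolding tails_run_def using exists_least_iff[of "\<lambda>n. B (x - 1 - int n)"] by blast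
  have "tails_run (Suc n) x B"
    unfolding tails_run_def
  proof (intro conjI allI impI)
    show "B (x - int (Suc n))" using n by (simp add: tails_run_def algebra_simps)
    fix j assume "j < Suc n"
    show "\<not> B (x - int j)"
    proof (cases j)
      case (Suc i)
      then show ?thesis using n \<open>j < Suc n\<close> by (auto simp: tails_run_def algebra_simps)
    qed (use False in simp)
  qed
  then show ?thesis using fill_iff_even_run[of "Suc n" x] fill_iff_even_run[OF n] False by simp
qed (simp add: fill_head)

lemma fill_cong_right:
  assumes "heads_recur B" "heads_recur B'" "fill B x = fill B' x" "\<And>y. x < y \<Longrightarrow> B y = B' y" "x \<le> y"
  shows "fill B y = fill B' y"
  using \<open>x \<le> y\<close>
proof (induction y rule: int_ge_induct)
  case (step y)
  then show ?case using fill_rec[of B "y + 1"] fill_rec[of B' "y + 1"] assms by simp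
qed (fact assms(3))

text \<open>This cyclic permutation of three coins preserves the coin-tossing measure and realises a jump of
  the particle system. If \<open>x - 1\<close> is occupied, the coins \<open>1, 0, b\<close> at \<open>x, x + 1, x + 2\<close> produce the
  sites \<open>1, 0, 1\<close> and the rotated coins \<open>0, b, 1\<close> produce \<open>0, 1, 1\<close>, for either value of \<open>b\<close>.\<close>

definition rotate_coins :: "int \<Rightarrow> config \<Rightarrow> config" where
  "rotate_coins x B = B(x := B (x + 1), x + 1 := B (x + 2), x + 2 := B x)"

text \<open>The states after a jump from \<open>x\<close> to \<open>x + 1\<close> out of a configuration with isolated holes: the
  site \<open>x + 2\<close> was occupied because \<open>x + 1\<close> was a hole.\<close>

definition jump_completed :: "int \<Rightarrow> config \<Rightarrow> bool" where
  "jump_completed x \<eta> \<longleftrightarrow> \<eta> (x - 1) \<and> \<not> \<eta> x \<and> \<eta> (x + 1) \<and> \<eta> (x + 2)"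

text \<open>Left of \<open>x\<close> the coins agree. At \<open>x + 2\<close> both fillings have a particle, and from there on the coins
  agree again, hence so do the fillings.\<close>

lemma rotate_coins_jump:
  assumes B: "heads_recur B" and B': "heads_recur (rotate_coins x B)"
  shows "jump_completed x (fill (rotate_coins x B)) \<longleftrightarrow> jump_allowed x (fill B)"
    and "jump_allowed x (fill B) \<Longrightarrow> fill (rotate_coins x B) = exchange x (fill B)"
proof -
  let ?B = "rotate_coins x B"
  have left: "fill ?B y = fill B y" if "y < x" for y
    by (rule fill_cong_left) (use that in \<open>simp add: rotate_coins_def\<close>)
  note rec = fill_rec[OF B, of x] fill_rec[OF B, of "x + 1"] fill_rec[OF B, of "x + 2"]
    fill_rec[OF B', of x] fill_rec[OF B', of "x + 1"] fill_rec[OF B', of "x + 2"]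
  have coins: "?B x = B (x + 1)" "?B (x + 1) = B (x + 2)" "?B (x + 2) = B x"
    by (simp_all add: rotate_coins_def)
  have pred: "x + 2 - 1 = x + 1" "x + 1 - 1 = x" by simp_all
  show "jump_completed x (fill ?B) \<longleftrightarrow> jump_allowed x (fill B)"
    using rec left[of "x - 1"] unfolding jump_completed_def jump_allowed_def coins pred by auto
  assume jump: "jump_allowed x (fill B)"
  have here: "\<not> fill ?B x" "fill ?B (x + 1)" "fill ?B (x + 2)" "fill B (x + 2)"
    using jump rec left[of "x - 1"] unfolding jump_allowed_def coins pred by auto
  have right: "fill ?B y = fill B y" if "x + 2 \<le> y" for y
    by (rule fill_cong_right[OF B' B _ _ that]) (use here in \<open>auto simp: rotate_coins_def\<close>)
  show "fill ?B = exchange x (fill B)"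
  proof
    fix y
    consider "y < x" | "y = x" | "y = x + 1" | "x + 2 \<le> y" by linarith
    then show "fill ?B y = exchange x (fill B) y"
      using left[of y] right[of y] here jump by cases (auto simp: exchange_def jump_allowed_def)
  qed
qed

lemma rotate_coins_eq_reindex:
  obtains \<sigma> where "inj \<sigma>" "rotate_coins x = (\<lambda>B n. B (\<sigma> n))"
proof
  let ?s = "id(x := x + 1, x + 1 := x + 2, x + 2 := x)"
  show "inj ?s" by (auto simp: inj_on_def split: if_splits)
  show "rotate_coins x = (\<lambda>B n. B (?s n))" by (auto simp: fun_eq_iff rotate_coins_def)
qed

section \<open>Invariance and density of the filled measure\<close>

context
  fixes q :: real
  assumes q: "0 < q" "q < 1"
begin

lemma measure_bernoulli: "measure (bernoulli_pmf q) {True} = q" "measure (bernoulli_pmf q) {False} = 1 - q"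
  using q by (simp_all add: measure_pmf_single)

text \<open>A run of \<open>k\<close> tails at given sites has probability \<open>(1 - q)\<^sup>k\<close>, which tends to \<open>0\<close>.\<close>

lemma AE_heads_recur: "AE B in coins q. heads_recur B"
proof -
  have [measurable_cong]: "sets (coins q) = sets borel" by (rule sets_coins)
  interpret prob_space "coins q" by (rule prob_onD[OF prob_on_coins])
  have sp: "space (coins q) = UNIV" by (rule prob_onD[OF prob_on_coins])
  have "AE B in coins q. \<exists>n. B (x - int n)" for x
  proof -
    let ?N = "{B\<in>space (coins q). \<forall>n. \<not> B (x - int n)}"
    have N: "?N \<in> sets (coins q)" by measurable
    have "measure (coins q) ?N \<le> (1 - q) ^ k" for k
    proof -
      let ?J = "(\<lambda>j. x - int j) ` {..<k}"
      have "?N \<subseteq> box ?J (\<lambda>_. {False})" by (auto simp: box_def)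
      moreover have "box ?J (\<lambda>_. {False}) \<in> sets (coins q)"
        unfolding sets_coins sets_borel_box by blast
      ultimately have "measure (coins q) ?N \<le> measure (coins q) (box ?J (\<lambda>_. {False}))"
        by (rule finite_measure_mono)
      also have "\<dots> = (1 - q) ^ card ?J"
        by (simp add: measure_coins_box measure_bernoulli)
      also have "card ?J = k" by (subst card_image) (auto simp: inj_on_def)
      finally show ?thesis .
    qed
    moreover have "(\<lambda>k. (1 - q) ^ k) \<longlonglongrightarrow> 0" using q by (intro LIMSEQ_power_zero) simp
    ultimately have "measure (coins q) ?N \<le> 0" by (intro LIMSEQ_le_const) auto
    then have "measure (coins q) ?N = 0" by (simp add: measure_le_0_iff)
    then show ?thesis using N by (subst (asm) prob_eq_0) auto
  qed
  then show ?thesis unfolding heads_recur_def by (simp add: AE_all_countable)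
qed

definition filled :: "config measure" where
  "filled = distr (coins q) borel fill"

lemma measurable_fill_coins [measurable]: "fill \<in> coins q \<rightarrow>\<^sub>M borel"
  using measurable_fill by (simp add: measurable_cong_sets[OF sets_coins refl])

lemma prob_on_filled: "prob_on filled"
  unfolding filled_def prob_on_def
  by (simp add: prob_space.prob_space_distr[OF prob_onD(1)[OF prob_on_coins]])

lemma measure_filled: "A \<in> sets borel \<Longrightarrow> measure filled A = measure (coins q) (fill -` A)"
  using prob_onD(3)[OF prob_on_coins] by (simp add: filled_def measure_distr)

lemma vimage_fill_sets: "A \<in> sets borel \<Longrightarrow> fill -` A \<in> sets borel"
  using measurable_sets[OF measurable_fill, of A] by simp

lemma translation_invariant_filled: "translation_invariant filled"
  unfolding translation_invariant_def
proof
  fix x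
  have sh: "shift_config x \<in> coins q \<rightarrow>\<^sub>M borel"
    using measurable_shift by (simp add: measurable_cong_sets[OF sets_coins refl])
  have "distr filled borel (shift_config x) = distr (coins q) borel (shift_config x \<circ> fill)"
    unfolding filled_def by (rule distr_distr) measurable
  also have "shift_config x \<circ> fill = fill \<circ> shift_config x" by (simp add: fun_eq_iff fill_shift)
  also have "distr (coins q) borel (fill \<circ> shift_config x) = distr (distr (coins q) borel (shift_config x)) borel fill"
    by (rule distr_distr[symmetric]) (use sh in measurable)
  also have "distr (coins q) borel (shift_config x) = coins q"
    using translation_invariant_coins by (simp add: translation_invariant_def)
  finally show "distr filled borel (shift_config x) = filled" by (simp add: filled_def)
qed

text \<open>Mixing passes to a measure obtained through a map that commutes with the shifts.\<close>

lemma mixing_filled: "mixing filled"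
  unfolding mixing_def
proof (intro ballI)
  fix A C :: "config set" assume A: "A \<in> sets borel" and C: "C \<in> sets borel"
  have "fill -` (A \<inter> shift_config a -` C) = fill -` A \<inter> shift_config a -` (fill -` C)" for a
    by (auto simp: fill_shift)
  then have "measure filled (A \<inter> shift_config a -` C) = measure (coins q) (fill -` A \<inter> shift_config a -` (fill -` C))" for a
    using A vimage_shift_sets[OF C] by (simp add: measure_filled)
  then show "(\<lambda>n. measure filled (A \<inter> shift_config (int n) -` C)) \<longlonglongrightarrow> measure filled A * measure filled C"
    using mixing_coins[of q] A C vimage_fill_sets by (simp add: mixing_def measure_filled)
qed

lemma AE_filled:
  assumes [measurable]: "Measurable.pred borel Q" and "AE B in coins q. Q (fill B)"
  shows "AE \<eta> in filled. Q \<eta>"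
  unfolding filled_def using assms(2) by (subst AE_distr_iff) auto

lemma AE_holes_isolated: "AE \<eta> in filled. \<forall>x. \<eta> x \<or> \<eta> (x + 1)"
proof (rule AE_filled)
  show "AE B in coins q. \<forall>x. fill B x \<or> fill B (x + 1)"
    using AE_heads_recur
  proof eventually_elim
    case (elim B)
    then show ?case using fill_rec[of B "_ + 1"] by auto
  qed
qed measurable

lemma integral_filled:
  fixes f :: "config \<Rightarrow> real"
  assumes "f \<in> borel_measurable borel"
  shows "(\<integral>\<eta>. f \<eta> \<partial>filled) = (\<integral>B. f (fill B) \<partial>coins q)"
  unfolding filled_def using assms by (intro integral_distr) auto

lemma measurable_jump_allowed [measurable]: "Measurable.pred borel (jump_allowed x)"
  unfolding jump_allowed_def by measurable

lemma measurable_jump_completed [measurable]: "Measurable.pred borel (jump_completed x)"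
  unfolding jump_completed_def by measurable

lemma measurable_exchange [measurable]: "exchange x \<in> borel \<rightarrow>\<^sub>M borel"
proof (rule measurable_config_map)
  fix y
  have "(\<lambda>\<eta>::config. exchange x \<eta> y) = (\<lambda>\<eta>. \<eta> (if y = x + 1 then x else if y = x then x + 1 else y))"
    by (auto simp: exchange_def)
  then show "(\<lambda>\<eta>. exchange x \<eta> y) \<in> borel \<rightarrow>\<^sub>M count_space UNIV" by simp
qed

text \<open>The change of variables given by \<open>rotate_coins\<close>: the expected rate at which jumps over the bond
  \<open>(x, x + 1)\<close> lead into a state is the probability weight of the states with pattern \<open>1011\<close> around
  that bond.\<close>

lemma integral_jump:
  fixes f :: "config \<Rightarrow> real"
  assumes [measurable]: "f \<in> borel_measurable borel"
  shows "(\<integral>\<eta>. of_bool (jump_allowed x \<eta>) * f (exchange x \<eta>) \<partial>filled)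
    = (\<integral>\<eta>. of_bool (jump_completed x \<eta>) * f \<eta> \<partial>filled)"
proof -
  obtain \<sigma> where \<sigma>: "inj \<sigma>" "rotate_coins x = (\<lambda>B n. B (\<sigma> n))" by (rule rotate_coins_eq_reindex)
  have inv: "distr (coins q) borel (rotate_coins x) = coins q"
    unfolding \<sigma>(2) by (rule distr_coins_reindex[OF \<sigma>(1)])
  have rot: "rotate_coins x \<in> coins q \<rightarrow>\<^sub>M borel"
  proof -
    have "rotate_coins x \<in> borel \<rightarrow>\<^sub>M borel"
      unfolding \<sigma>(2) by (rule measurable_config_map) measurable
    then show ?thesis by (simp add: measurable_cong_sets[OF sets_coins refl])
  qed
  let ?g = "\<lambda>\<eta>. of_bool (jump_completed x \<eta>) * f \<eta>"
  have "AE B in distr (coins q) borel (rotate_coins x). heads_recur B"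
    unfolding inv by (rule AE_heads_recur)
  then have rec': "AE B in coins q. heads_recur (rotate_coins x B)"
    by (rule AE_distrD[OF rot])
  have "(\<integral>\<eta>. ?g \<eta> \<partial>filled) = (\<integral>B. ?g (fill B) \<partial>coins q)" by (rule integral_filled) measurable
  also have "\<dots> = (\<integral>B. ?g (fill B) \<partial>distr (coins q) borel (rotate_coins x))" by (simp only: inv)
  also have "\<dots> = (\<integral>B. ?g (fill (rotate_coins x B)) \<partial>coins q)"
    by (rule integral_distr[OF rot]) measurable
  also have "\<dots> = (\<integral>B. of_bool (jump_allowed x (fill B)) * f (exchange x (fill B)) \<partial>coins q)"
  proof (rule integral_cong_AE)
    show "(\<lambda>B. ?g (fill (rotate_coins x B))) \<in> borel_measurable (coins q)"
      by (rule measurable_compose[OF rot]) measurable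
    show "(\<lambda>B. of_bool (jump_allowed x (fill B)) * f (exchange x (fill B))) \<in> borel_measurable (coins q)"
      by measurable
    show "AE B in coins q. ?g (fill (rotate_coins x B)) = of_bool (jump_allowed x (fill B)) * f (exchange x (fill B))"
      using AE_heads_recur rec'
    proof eventually_elim
      case (elim B)
      then show ?case
        using rotate_coins_jump[OF elim] by (cases "jump_allowed x (fill B)") simp_all
    qed
  qed
  also have "\<dots> = (\<integral>\<eta>. of_bool (jump_allowed x \<eta>) * f (exchange x \<eta>) \<partial>filled)"
    by (rule integral_filled[symmetric]) measurable
  finally show ?thesis by simp
qed

text \<open>With \<open>h\<^sub>x = 1 - \<eta>(x)\<close>, the shift of this function by \<open>x\<close> is \<open>h\<^sub>x + h\<^bsub>x-1\<^esub> h\<^bsub>x+1\<^esub>\<close>.\<close>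

definition flux :: "config \<Rightarrow> real" where
  "flux \<eta> = indicator {\<eta>. \<not> \<eta> 0} \<eta> + indicator {\<eta>. \<not> \<eta> (- 1) \<and> \<not> \<eta> 1} \<eta>"

text \<open>When holes are isolated, the pattern \<open>1011\<close> around \<open>x\<close> has indicator \<open>h\<^sub>x - h\<^sub>x h\<^bsub>x+2\<^esub>\<close> and
  \<open>110\<close> has indicator \<open>h\<^bsub>x+1\<^esub> - h\<^bsub>x-1\<^esub> h\<^bsub>x+1\<^esub>\<close>. So the excess of gain over loss is a discrete gradient,
  and the total excess over an interval is a boundary term.\<close>

lemma jump_telescopes:
  assumes "\<And>x. \<eta> x \<or> \<eta> (x + 1)"
  shows "of_bool (jump_completed x \<eta>) - of_bool (jump_allowed x \<eta>)
    = flux (shift_config x \<eta>) - flux (shift_config (x + 1) \<eta>)"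
  using assms[of "x - 1"] assms[of x] assms[of "x + 1"]
  by (auto simp: jump_completed_def jump_allowed_def flux_def shift_config_def indicator_def algebra_simps)

text \<open>By \<open>integral_jump\<close> and \<open>jump_telescopes\<close> the integral is the difference of the correlations of \<open>f\<close>
  with the flux at the left and at the right end of any sufficiently large interval around the sites on
  which \<open>f\<close> depends. As both ends move to infinity, mixing decouples \<open>f\<close> from the flux, and the two
  correlations have the same limit.\<close>

lemma generator_integral_filled:
  assumes P: "ftasep P" and f: "cylinder f"
  shows "(\<integral>\<eta>. ftasep_generator f \<eta> \<partial>filled) = 0"
proof -
  note \<mu> = prob_on_filled
  have [measurable_cong]: "sets filled = sets borel" by (rule prob_onD[OF \<mu>])
  interpret prob_space filled by (rule prob_onD[OF \<mu>])
  have fm[measurable]: "f \<in> borel_measurable borel" by (rule cylinder_measurable[OF P f])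
  obtain m where m: "depends_on (window m) f" using f cylinder_window by blast
  obtain C where C: "0 \<le> C" "\<And>\<eta>. \<bar>f \<eta>\<bar> \<le> C" using cylinder_bounded[OF f] by blast
  have flux[measurable]: "flux \<in> borel_measurable borel" unfolding flux_def by measurable
  have flux_le: "\<bar>flux \<eta>\<bar> \<le> 2" for \<eta> by (auto simp: flux_def indicator_def)
  let ?I = "\<integral>\<eta>. ftasep_generator f \<eta> \<partial>filled"
  let ?J = "\<lambda>x. \<integral>\<eta>. f \<eta> * flux (shift_config x \<eta>) \<partial>filled"
  have int: "integrable filled (\<lambda>\<eta>. f \<eta> * flux (shift_config x \<eta>))" for x
    using mult_mono[OF C(2) flux_le] C by (intro prob_on_integrable[OF \<mu>, of _ "C * 2"]) (auto simp: abs_mult)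
  have intb: "integrable filled (\<lambda>\<eta>. of_bool (Q \<eta>) * f (g \<eta>))"
    if [measurable]: "Measurable.pred borel Q" "g \<in> borel \<rightarrow>\<^sub>M borel" for Q g
    using C by (intro prob_on_integrable[OF \<mu>, of _ C]) (auto simp: abs_mult of_bool_def)
  have step: "(\<integral>\<eta>. of_bool (jump_allowed x \<eta>) * (f (exchange x \<eta>) - f \<eta>) \<partial>filled) = ?J x - ?J (x + 1)" for x
  proof -
    note ints = intb[of "jump_allowed x" "exchange x"] intb[of "jump_allowed x" id] intb[of "jump_completed x" id]
    have "(\<integral>\<eta>. of_bool (jump_allowed x \<eta>) * (f (exchange x \<eta>) - f \<eta>) \<partial>filled)
        = (\<integral>\<eta>. of_bool (jump_allowed x \<eta>) * f (exchange x \<eta>) \<partial>filled) - (\<integral>\<eta>. of_bool (jump_allowed x \<eta>) * f \<eta> \<partial>filled)"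
      using ints by (simp add: right_diff_distrib)
    also have "\<dots> = (\<integral>\<eta>. of_bool (jump_completed x \<eta>) * f \<eta> - of_bool (jump_allowed x \<eta>) * f \<eta> \<partial>filled)"
      unfolding integral_jump[OF fm] using ints by simp
    also have "\<dots> = (\<integral>\<eta>. f \<eta> * flux (shift_config x \<eta>) - f \<eta> * flux (shift_config (x + 1) \<eta>) \<partial>filled)"
    proof (rule integral_cong_AE)
      show "AE \<eta> in filled. of_bool (jump_completed x \<eta>) * f \<eta> - of_bool (jump_allowed x \<eta>) * f \<eta>
          = f \<eta> * flux (shift_config x \<eta>) - f \<eta> * flux (shift_config (x + 1) \<eta>)"
        using AE_holes_isolated
      proof eventually_elim
        case (elim \<eta>)
        then have "(of_bool (jump_completed x \<eta>) - of_bool (jump_allowed x \<eta>)) * f \<eta>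
            = (flux (shift_config x \<eta>) - flux (shift_config (x + 1) \<eta>)) * f \<eta>"
          by (subst jump_telescopes) auto
        then show ?case by (simp add: algebra_simps)
      qed
    qed measurable
    also have "\<dots> = ?J x - ?J (x + 1)" using int by simp
    finally show ?thesis .
  qed
  \<comment> \<open>The ends of the interval are free as long as it covers every jump that can change \<open>f\<close>.\<close>
  have I: "?I = ?J (- int (m + 1 + n)) - ?J (int (m + 1 + n))" for n
  proof -
    let ?a = "- int (m + 1 + n)" and ?b = "int (m + 1 + n)"
    have "ftasep_generator f \<eta> = (\<Sum>x\<in>{?a..<?b}. of_bool (jump_allowed x \<eta>) * (f (exchange x \<eta>) - f \<eta>))" for \<eta>
      by (rule generator_eq_sum[of "- int m" "int m"]) (use m in \<open>auto simp: window_def\<close>)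
    then have "?I = (\<Sum>x\<in>{?a..<?b}. \<integral>\<eta>. of_bool (jump_allowed x \<eta>) * (f (exchange x \<eta>) - f \<eta>) \<partial>filled)"
      using intb[of "jump_allowed _" "exchange _"] intb[of "jump_allowed _" id]
      by (simp add: right_diff_distrib)
    also have "\<dots> = (\<Sum>x\<in>{?a..<?b}. ?J x - ?J (x + 1))" by (simp only: step)
    also have "\<dots> = ?J ?a - ?J ?b"
    proof -
      have "(\<Sum>x\<in>{a..<a + int k}. ?J x - ?J (x + 1)) = ?J a - ?J (a + int k)" for a k
      proof (induction k)
        case (Suc k)
        have "{a..<a + int (Suc k)} = insert (a + int k) {a..<a + int k}" by auto
        then show ?case using Suc by (simp add: algebra_simps)
      qed simp
      from this[of ?a "2 * (m + 1 + n)"] show ?thesis by simp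
    qed
    finally show ?thesis .
  qed
  define c where "c = (\<integral>\<eta>. f \<eta> \<partial>filled) * measure filled {\<eta>. \<not> \<eta> 0} + (\<integral>\<eta>. f \<eta> \<partial>filled) * measure filled {\<eta>. \<not> \<eta> (- 1) \<and> \<not> \<eta> 1}"
  have sets: "{\<eta>::config. \<not> \<eta> 0} \<in> sets borel" "{\<eta>::config. \<not> \<eta> (- 1) \<and> \<not> \<eta> 1} \<in> sets borel"
  proof -
    have "{\<eta>\<in>space (borel :: config measure). \<not> \<eta> 0} \<in> sets borel"
      "{\<eta>\<in>space (borel :: config measure). \<not> \<eta> (- 1) \<and> \<not> \<eta> 1} \<in> sets borel" by measurable
    then show "{\<eta>::config. \<not> \<eta> 0} \<in> sets borel" "{\<eta>::config. \<not> \<eta> (- 1) \<and> \<not> \<eta> 1} \<in> sets borel" by simp_all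
  qed
  have split: "?J x = (\<integral>\<eta>. f \<eta> * indicator {\<eta>. \<not> \<eta> 0} (shift_config x \<eta>) \<partial>filled)
      + (\<integral>\<eta>. f \<eta> * indicator {\<eta>. \<not> \<eta> (- 1) \<and> \<not> \<eta> 1} (shift_config x \<eta>) \<partial>filled)" for x
  proof -
    have "integrable filled (\<lambda>\<eta>. f \<eta> * indicator S (shift_config x \<eta>))" if [measurable]: "S \<in> sets borel" for S
      using C by (intro prob_on_integrable[OF \<mu>, of _ C]) (auto simp: abs_mult indicator_def)
    then show ?thesis unfolding flux_def using sets by (simp add: distrib_left)
  qed
  note lim = mixing_integral[OF \<mu> translation_invariant_filled mixing_filled fm cylinder_finite_range[OF f]]
  have "(\<lambda>n. ?J (- int n)) \<longlonglongrightarrow> c" "(\<lambda>n. ?J (int n)) \<longlonglongrightarrow> c"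
    unfolding split c_def by (intro tendsto_add lim sets)+
  then have "(\<lambda>n. ?J (- int n) - ?J (int n)) \<longlonglongrightarrow> c - c" by (rule tendsto_diff)
  then have "(\<lambda>n. ?J (- int (n + (m + 1))) - ?J (int (n + (m + 1)))) \<longlonglongrightarrow> c - c"
    by (rule LIMSEQ_ignore_initial_segment)
  then have "(\<lambda>n::nat. ?I) \<longlonglongrightarrow> c - c"
    using I by (simp add: add.commute add.left_commute)
  then show ?thesis by (simp add: LIMSEQ_const_iff)
qed

lemma measure_tails_run: "measure (coins q) {B. tails_run n x B} = q * (1 - q) ^ n"
proof -
  let ?J = "(\<lambda>j. x - int j) ` {..<n}" and ?X = "\<lambda>i. if i = x - int n then {True} else {False}"
  have "{B. tails_run n x B} = box (insert (x - int n) ?J) ?X"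
    by (auto simp: tails_run_def box_def)
  moreover have "x - int n \<notin> ?J" by auto
  moreover have "(\<Prod>i\<in>?J. measure (bernoulli_pmf q) (?X i)) = (1 - q) ^ n"
  proof -
    have "(\<Prod>i\<in>?J. measure (bernoulli_pmf q) (?X i)) = (\<Prod>i\<in>?J. 1 - q)"
      by (rule prod.cong) (auto simp: measure_bernoulli)
    also have "\<dots> = (1 - q) ^ n" by (simp add: card_image inj_on_def)
    finally show ?thesis .
  qed
  ultimately show ?thesis by (simp add: measure_coins_box measure_bernoulli)
qed

text \<open>A site is empty iff the run of tails ending there has odd length, so holes have density
  \<open>\<Sum>k. q (1 - q)\<^bsup>2k+1\<^esup> = (1 - q) / (2 - q)\<close>.\<close>

lemma density_filled: "has_density filled (1 / (2 - q))"
  unfolding has_density_def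
proof
  fix x
  interpret prob_space "coins q" by (rule prob_onD[OF prob_on_coins])
  have sp: "space (coins q) = UNIV" by (rule prob_onD[OF prob_on_coins])
  have meas: "{B. Q B} \<in> sets (coins q)" if "Measurable.pred borel Q" for Q
    using that by (simp add: sets_coins pred_def)
  let ?A = "\<lambda>k. {B. tails_run (2 * k + 1) x B}"
  have "disjoint_family ?A"
  proof -
    have "?A m \<inter> ?A n = {}" if "m \<noteq> n" for m n
      using that by (auto dest: tails_run_unique)
    then show ?thesis unfolding disjoint_family_on_def by blast
  qed
  then have "(\<lambda>k. measure (coins q) (?A k)) sums measure (coins q) (\<Union>k. ?A k)"
    by (intro finite_measure_UNION) (auto intro!: meas)
  moreover have "(\<Union>k. ?A k) = UNIV - {B. fill B x}"
  proof -
    have "(\<exists>k. tails_run (2 * k + 1) x B) \<longleftrightarrow> (\<exists>n. odd n \<and> tails_run n x B)" for B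
    proof
      assume "\<exists>k. tails_run (2 * k + 1) x B"
      then obtain k where "tails_run (2 * k + 1) x B" by blast
      then show "\<exists>n. odd n \<and> tails_run n x B" by (intro exI[of _ "2 * k + 1"]) simp
    qed (blast elim: oddE)
    then show ?thesis by (auto simp: fill_def)
  qed
  moreover have "{B. fill B x} \<in> sets (coins q)"
    by (rule meas) measurable
  ultimately have "(\<lambda>k. q * (1 - q) ^ (2 * k + 1)) sums (1 - measure (coins q) {B. fill B x})"
    using prob_compl[of "{B. fill B x}"] sp by (simp add: measure_tails_run)
  moreover have "(\<lambda>k. q * (1 - q) * ((1 - q)\<^sup>2) ^ k) sums (q * (1 - q) * (1 / (1 - (1 - q)\<^sup>2)))"
    using q by (intro sums_mult geometric_sums) (simp add: abs_square_less_1)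
  moreover have "q * (1 - q) * ((1 - q)\<^sup>2) ^ k = q * (1 - q) ^ (2 * k + 1)" for k
    by (simp add: power_mult)
  ultimately have "1 - measure (coins q) {B. fill B x} = q * (1 - q) * (1 / (1 - (1 - q)\<^sup>2))"
    using sums_unique2 by simp
  also have "1 - (1 - q)\<^sup>2 = q * (2 - q)" by (simp add: power2_eq_square algebra_simps)
  finally have "measure (coins q) {B. fill B x} = 1 - (1 - q) / (2 - q)" using q by simp
  also have "\<dots> = 1 / (2 - q)" using q by (simp add: field_simps)
  finally show "measure filled {\<eta>. \<eta> x} = 1 / (2 - q)"
    using measure_filled[of "{\<eta>. \<eta> x}"] measurable_site[of x] by (simp add: vimage_def pred_def)
qed

text \<open>Two adjacent heads are two adjacent particles.\<close>

lemma nondegenerate_filled: "\<not> degenerate filled"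
proof
  assume "degenerate filled"
  then have "measure filled {\<eta>. \<eta> 0 \<and> \<eta> (0 + 1)} = 0" unfolding degenerate_def by blast
  moreover have pair: "{\<eta>::config. \<eta> 0 \<and> \<eta> 1} \<in> sets borel"
  proof -
    have "{\<eta>\<in>space (borel :: config measure). \<eta> 0 \<and> \<eta> 1} \<in> sets borel" by measurable
    then show ?thesis by simp
  qed
  ultimately have "measure (coins q) (fill -` {\<eta>. \<eta> 0 \<and> \<eta> 1}) = 0"
    by (simp add: measure_filled)
  moreover have "measure (coins q) (box {0, 1} (\<lambda>_. {True})) \<le> measure (coins q) (fill -` {\<eta>. \<eta> 0 \<and> \<eta> 1})"
    using vimage_fill_sets[OF pair] prob_onD(1)[OF prob_on_coins]
    by (intro finite_measure.finite_measure_mono) (auto simp: box_def fill_head sets_coins prob_space_def)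
  moreover have "measure (coins q) (box {0, 1} (\<lambda>_. {True})) = q * q"
    by (simp add: measure_coins_box measure_bernoulli)
  ultimately show False using mult_pos_pos[OF q(1) q(1)] by simp
qed

end

section \<open>The theorem\<close>

theorem exists_invariant_high_density:
  assumes P: "ftasep P" and \<rho>: "1 / 2 < \<rho>" "\<rho> < 1"
  shows "\<exists>\<mu>. prob_on \<mu> \<and> translation_invariant \<mu> \<and> spatially_ergodic \<mu> \<and>
    \<not> degenerate \<mu> \<and> has_density \<mu> \<rho> \<and> invariant_for P \<mu>"
proof -
  \<comment> \<open>The solution of \<open>1 / (2 - q) = \<rho>\<close>; it lies in \<open>(0, 1)\<close> exactly when \<open>1 / 2 < \<rho> < 1\<close>.\<close>
  define q where "q = 2 - 1 / \<rho>"
  have q: "0 < q" "q < 1" "1 / (2 - q) = \<rho>" using \<rho> by (auto simp: q_def field_simps)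
  note \<mu> = prob_on_filled[OF q(1,2)] translation_invariant_filled[OF q(1,2)]
  have "spatially_ergodic (filled q)"
    by (rule ergodic_if_mixing[OF \<mu> mixing_filled[OF q(1,2)]])
  moreover have "invariant_for P (filled q)"
    by (rule invariant_if_generator_zero[OF P \<mu>(1) generator_integral_filled[OF q(1,2) P]])
  ultimately show ?thesis
    using \<mu> nondegenerate_filled[OF q(1,2)] density_filled[OF q(1,2)] q(3) by metis
qed

theorem theorem1:
  fixes P :: "real \<Rightarrow> config \<Rightarrow> config measure"
  assumes "ftasep P"
  shows "(\<forall>\<rho>::real. 1 / 2 < \<rho> \<and> \<rho> < 1 \<longrightarrow>
            (\<exists>\<mu>. prob_on \<mu> \<and> translation_invariant \<mu> \<and> spatially_ergodic \<mu> \<and>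
                 \<not> degenerate \<mu> \<and> has_density \<mu> \<rho> \<and> invariant_for P \<mu>)) \<and>
         (\<forall>\<rho>::real. 0 < \<rho> \<and> \<rho> \<le> 1 / 2 \<longrightarrow>
            \<not> (\<exists>\<mu>. prob_on \<mu> \<and> translation_invariant \<mu> \<and> spatially_ergodic \<mu> \<and>
                 \<not> degenerate \<mu> \<and> has_density \<mu> \<rho> \<and> invariant_for P \<mu>))"
  using exists_invariant_high_density[OF assms] no_invariant_low_density[OF assms]
  by (meson not_less)

end
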